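(* Let $G=\mathrm{SL}_2(\mathbb{F}_3)$ act by conjugation on the space $M$ of trace-zero $2\times 2$ matrices over $\mathbb{F}_3$, and let $R=S(M^* )\otimes\Lambda(M^* )$ with the induced $G$-action. Let $x_1,x_2,x_3$ (generating $S(M^* )$) and $y_1,y_2,y_3$ (generating $\Lambda(M^* )$) be the generators corresponding to the dual basis of the basis $v_1,v_2,v_3$ of $M$ fixed in the context. Put \begin{align*} a_1&=x_1^2+x_2^2+x_3^2,\\ a_2&=x_1x_2x_3,\\ a_3&=x_1^4+x_2^4+x_3^4,\\ b&=x_1^4x_2^2+x_1^2x_3^4+x_2^4x_3^2,\\ c_1&=x_1y_1+x_2y_2+x_3y_3,\\ c_2&=x_2x_3y_1+x_3x_1y_2+x_1x_2y_3,\\ c_3&=x_1^3y_1+x_2^3y_2+x_3^3y_3,\\ c_4&=x_1x_2^2y_1+x_2x_3^2y_2+x_3x_1^2y_3,\\ c_5&=x_2^3x_3y_1+x_3^3x_1y_2+x_1^3x_2y_3,\\ c_6&=x_1^3x_2^2y_1+x_2^3x_3^2y_2+x_3^3x_1^2y_3,\\ d_1&=x_1y_2y_3+x_2y_3y_1+x_3y_1y_2,\\ d_2&=x_2x_3y_2y_3+x_3x_1y_3y_1+x_1x_2y_1y_2,\\ d_3&=x_1^3y_2y_3+x_2^3y_3y_1+x_3^3y_1y_2. \end{align*} Then the algebra of invariants $R^G$ is minimally generated, as a commutative-graded $\mathbb{F}_3$-algebra, by $$\{a_1,a_2,a_3,b,c_1,c_2,c_3,c_4,c_5,c_6,d_1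,d_2,d_3,y_1y_2y_3\}.$$
   Context: $G$ acts on $M$ by $g(v)=gvg^{-1}$, and on $M^*$ by $(g(f))(v)=f(g^{-1}(v))$; this extends by algebra automorphisms to the symmetric algebra $S(M^* )$, the exterior algebra $\Lambda(M^* )$, and diagonally to $R=S(M^* )\otimes\Lambda(M^* )$. $R^G$ denotes the subalgebra of $G$-fixed elements. The basis of $M$ is $$v_1=\begin{pmatrix}0&1\\-1&0\end{pmatrix},\quad v_2=\begin{pmatrix}-1&-1\\-1&1\end{pmatrix},\quad v_3=\begin{pmatrix}1&-1\\-1&-1\end{pmatrix}.$$ $x_1,x_2,x_3$ is the dual basis of $M^*$ viewed in $S(M^* )$, and $y_1,y_2,y_3$ is the same dual basis viewed in $\Lambda^1(M^* )\subset\Lambda(M^* )$. Thus $R$ is the free graded-commutative $\mathbb{F}_3$-algebra on $x_1,x_2,x_3$ (degree $2$) and $y_1,y_2,y_3$ (degree $1$): $fg=(-1)^{\deg(f)\deg(g)}gf$ for homogeneous $f,g$ (so the $x_i$ are central, $y_iy_j=-y_jy_i$, $y_i^2=0$). "Minimally generated by a set" means that the set generates the algebra and no proper subset of it does. *)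

theory Defs
  imports "HOL-Analysis.Analysis" "HOL-Library.Poly_Mapping"
begin

section \<open>The exterior algebra of a free module with an ordered finite basis\<close>

text \<open>
  An element of the exterior algebra over a commutative ring \<open>'a\<close> on generators \<open>y\<^sub>i\<close> is written
  uniquely as \<open>\<Sum>T. c\<^sub>T y\<^sub>T\<close>, where \<open>y\<^sub>T\<close> is the product of the \<open>y\<^sub>i\<close> with \<open>i \<in> T\<close> in
  increasing order of \<open>i\<close>. It is represented by its coefficient family \<open>T \<mapsto> c\<^sub>T\<close>.
\<close>

typedef ('i, 'a) ext_alg = "UNIV :: ('i set \<Rightarrow> 'a) set"
  morphisms ext_coeff Ext ..

lemma ext_coeff_Ext [simp]: "ext_coeff (Ext f) = f"
  by (simp add: Ext_inverse)

lemma ext_alg_eqI: "(\<And>T. ext_coeff r T = ext_coeff s T) \<Longrightarrow> r = s"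
  by (metis ext ext_coeff_inject)

text \<open>
  For disjoint \<open>S\<close> and \<open>T\<close>, \<open>y\<^sub>S y\<^sub>T = ext_sign S T \<cdot> y\<^bsub>S \<union> T\<^esub>\<close>: the sign counts the
  transpositions needed to sort the product.
\<close>

definition ext_sign :: "'i::linorder set \<Rightarrow> 'i set \<Rightarrow> 'a::comm_ring_1" where
  "ext_sign S T = (-1) ^ card {(s, t). s \<in> S \<and> t \<in> T \<and> t < s}"

lemma ext_sign_empty [simp]: "ext_sign {} T = 1" "ext_sign S {} = 1"
  by (simp_all add: ext_sign_def)

lemma ext_sign_Un_left:
  fixes S S' T :: "'i::{finite,linorder} set"
  assumes "S \<inter> S' = {}"
  shows "(ext_sign (S \<union> S') T :: 'a::comm_ring_1) = ext_sign S T * ext_sign S' T"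
proof -
  have "{(s, t). s \<in> S \<union> S' \<and> t \<in> T \<and> t < s} =
      {(s, t). s \<in> S \<and> t \<in> T \<and> t < s} \<union> {(s, t). s \<in> S' \<and> t \<in> T \<and> t < s}"
    by auto
  moreover have "card \<dots> = card {(s, t). s \<in> S \<and> t \<in> T \<and> t < s} +
      card {(s, t). s \<in> S' \<and> t \<in> T \<and> t < s}"
    using assms by (intro card_Un_disjoint) auto
  ultimately show ?thesis by (simp add: ext_sign_def power_add)
qed

lemma ext_sign_Un_right:
  fixes S T T' :: "'i::{finite,linorder} set"
  assumes "T \<inter> T' = {}"
  shows "(ext_sign S (T \<union> T') :: 'a::comm_ring_1) = ext_sign S T * ext_sign S T'"
proof -
  have "{(s, t). s \<in> S \<and> t \<in> T \<union> T' \<and> t < s} =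
      {(s, t). s \<in> S \<and> t \<in> T \<and> t < s} \<union> {(s, t). s \<in> S \<and> t \<in> T' \<and> t < s}"
    by auto
  moreover have "card \<dots> = card {(s, t). s \<in> S \<and> t \<in> T \<and> t < s} +
      card {(s, t). s \<in> S \<and> t \<in> T' \<and> t < s}"
    using assms by (intro card_Un_disjoint) auto
  ultimately show ?thesis by (simp add: ext_sign_def power_add)
qed

lemma ext_sign_singleton_left:
  "(ext_sign {m} T :: 'a::comm_ring_1) = (-1) ^ card {t \<in> T. t < m}"
proof -
  have "{(s, t). s \<in> {m} \<and> t \<in> T \<and> t < s} = (\<lambda>t. (m, t)) ` {t \<in> T. t < m}"
    by auto
  then show ?thesis
    by (simp add: ext_sign_def card_image inj_on_def)
qed

lemma ext_sign_singletons:
  "(ext_sign {i} {j} :: 'a::comm_ring_1) = (if j < i then - 1 else 1)"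
proof -
  have "{t \<in> {j}. t < i} = (if j < i then {j} else {})" by auto
  then show ?thesis unfolding ext_sign_singleton_left by simp
qed

instantiation ext_alg :: ("{finite,linorder}", comm_ring_1) ring_1
begin

definition "0 = Ext (\<lambda>T. 0)"
definition "1 = Ext (\<lambda>T. if T = {} then 1 else 0)"
definition "r + s = Ext (\<lambda>T. ext_coeff r T + ext_coeff s T)"
definition "- r = Ext (\<lambda>T. - ext_coeff r T)"
definition "r - s = Ext (\<lambda>T. ext_coeff r T - ext_coeff s T)"
definition "r * s =
  Ext (\<lambda>U. \<Sum>T\<in>Pow U. ext_sign T (U - T) * ext_coeff r T * ext_coeff s (U - T))"

instance
proof
  fix a b c :: "('a, 'b) ext_alg"
  show "a + b + c = a + (b + c)" "a + b = b + a" "0 + a = a" "- a + a = 0" "a - b = a + - b"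
    by (simp_all add: plus_ext_alg_def zero_ext_alg_def uminus_ext_alg_def
        minus_ext_alg_def add_ac ext_coeff_inverse)
  show "(a + b) * c = a * c + b * c" "a * (b + c) = a * b + a * c"
    by (simp_all add: plus_ext_alg_def times_ext_alg_def algebra_simps sum.distrib)
  show "0 \<noteq> (1 :: ('a, 'b) ext_alg)"
    unfolding zero_ext_alg_def one_ext_alg_def by (simp add: Ext_inject fun_eq_iff)
  show "1 * a = a"
  proof (rule ext_alg_eqI)
    fix U
    have "ext_coeff (1 * a) U = (\<Sum>T\<in>Pow U. if T = {} then ext_coeff a U else 0)"
      unfolding times_ext_alg_def one_ext_alg_def ext_coeff_Ext
      by (intro sum.cong) auto
    then show "ext_coeff (1 * a) U = ext_coeff a U" by simp
  qed
  show "a * 1 = a"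
  proof (rule ext_alg_eqI)
    fix U
    have "ext_coeff (a * 1) U = (\<Sum>T\<in>Pow U. if T = U then ext_coeff a U else 0)"
      unfolding times_ext_alg_def one_ext_alg_def ext_coeff_Ext
      by (intro sum.cong) auto
    then show "ext_coeff (a * 1) U = ext_coeff a U" by simp
  qed
  show "a * b * c = a * (b * c)"
  proof (rule ext_alg_eqI)
    fix U
    let ?f = "\<lambda>(A, B). ext_sign A B * ext_sign (A \<union> B) (U - (A \<union> B)) *
      (ext_coeff a A * ext_coeff b B * ext_coeff c (U - (A \<union> B)))"
    let ?P = "{(A, B). A \<subseteq> U \<and> B \<subseteq> U \<and> A \<inter> B = {}}"
    have "ext_coeff (a * b * c) U = (\<Sum>T\<in>Pow U. \<Sum>A\<in>Pow T. ?f (A, T - A))"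
      unfolding times_ext_alg_def ext_coeff_Ext sum_distrib_left sum_distrib_right
      by (intro sum.cong refl) (auto simp: Un_absorb1 algebra_simps)
    also have "\<dots> = (\<Sum>(T, A)\<in>(SIGMA T:Pow U. Pow T). ?f (A, T - A))"
      by (rule sum.Sigma) auto
    also have "\<dots> = sum ?f ?P"
      by (rule sum.reindex_bij_witness[where i = "\<lambda>(A, B). (A \<union> B, A)"
            and j = "\<lambda>(T, A). (A, T - A)"]) auto
    also have "\<dots> = (\<Sum>(A, B)\<in>(SIGMA A:Pow U. Pow (U - A)). ?f (A, B))"
      by (rule sum.cong) auto
    also have "\<dots> = (\<Sum>A\<in>Pow U. \<Sum>B\<in>Pow (U - A). ?f (A, B))"
      by (rule sum.Sigma[symmetric]) auto
    also have "\<dots> = ext_coeff (a * (b * c)) U"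
      unfolding times_ext_alg_def ext_coeff_Ext sum_distrib_left sum_distrib_right
    proof (intro sum.cong refl)
      fix A B assume "A \<in> Pow U" "B \<in> Pow (U - A)"
      then have "A \<inter> B = {}" "B \<inter> (U - A - B) = {}" and eq: "U - A = B \<union> (U - A - B)"
          "U - (A \<union> B) = U - A - B"
        by auto
      have "(ext_sign A B * ext_sign (A \<union> B) (U - (A \<union> B)) :: 'b) =
          ext_sign A (U - A) * ext_sign B (U - A - B)"
        unfolding eq(2) ext_sign_Un_left[OF \<open>A \<inter> B = {}\<close>]
        by (subst eq(1), subst ext_sign_Un_right[OF \<open>B \<inter> (U - A - B) = {}\<close>]) simp
      then have "(ext_sign A B * ext_sign (A \<union> B) (U - (A \<union> B))) *
          (ext_coeff a A * ext_coeff b B * ext_coeff c (U - (A \<union> B))) =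
          (ext_sign A (U - A) * ext_sign B (U - A - B)) *
          (ext_coeff a A * ext_coeff b B * ext_coeff c (U - A - B))"
        by (simp only: eq(2))
      then show "?f (A, B) = ext_sign A (U - A) * ext_coeff a A *
          (ext_sign B (U - A - B) * ext_coeff b B * ext_coeff c (U - A - B))"
        by (simp only: case_prod_conv mult_ac)
    qed
    finally show "ext_coeff (a * b * c) U = ext_coeff (a * (b * c)) U" .
  qed
qed

end

lemma ext_coeff_simps [simp]:
  "ext_coeff 0 T = 0" "ext_coeff (r + s) T = ext_coeff r T + ext_coeff s T"
  "ext_coeff (- r) T = - ext_coeff r T" "ext_coeff (r - s) T = ext_coeff r T - ext_coeff s T"
  by (simp_all add: zero_ext_alg_def plus_ext_alg_def uminus_ext_alg_def minus_ext_alg_def)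

lemma ext_coeff_sum: "ext_coeff (sum f A) T = (\<Sum>i\<in>A. ext_coeff (f i) T)"
  by (induction A rule: infinite_finite_induct) auto

definition ext_const :: "'a \<Rightarrow> ('i, 'a::comm_ring_1) ext_alg" where
  "ext_const c = Ext (\<lambda>T. if T = {} then c else 0)"

definition ext_gen :: "'i \<Rightarrow> ('i, 'a::comm_ring_1) ext_alg" where
  "ext_gen i = Ext (\<lambda>T. if T = {i} then 1 else 0)"

lemma ext_coeff_const [simp]: "ext_coeff (ext_const c) T = (if T = {} then c else 0)"
  by (simp add: ext_const_def)

lemma ext_coeff_const_mult [simp]:
  fixes r :: "('i::{finite,linorder}, 'a::comm_ring_1) ext_alg"
  shows "ext_coeff (ext_const c * r) U = c * ext_coeff r U"
proof -
  have "ext_coeff (ext_const c * r) U = (\<Sum>T\<in>Pow U. if T = {} then c * ext_coeff r U else 0)"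
    unfolding times_ext_alg_def ext_const_def ext_coeff_Ext by (intro sum.cong) auto
  then show ?thesis by simp
qed

lemma ext_coeff_mult_const [simp]:
  fixes r :: "('i::{finite,linorder}, 'a::comm_ring_1) ext_alg"
  shows "ext_coeff (r * ext_const c) U = c * ext_coeff r U"
proof -
  have "ext_coeff (r * ext_const c) U = (\<Sum>T\<in>Pow U. if T = U then c * ext_coeff r U else 0)"
    unfolding times_ext_alg_def ext_const_def ext_coeff_Ext by (intro sum.cong) auto
  then show ?thesis by simp
qed

lemma ext_const_central:
  "ext_const c * r = r * (ext_const c :: ('i::{finite,linorder}, 'a::comm_ring_1) ext_alg)"
  by (rule ext_alg_eqI) simp

lemma ext_const_hom:
  "ext_const 0 = (0 :: ('i::{finite,linorder}, 'a::comm_ring_1) ext_alg)"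
  "ext_const 1 = (1 :: ('i::{finite,linorder}, 'a::comm_ring_1) ext_alg)"
  "ext_const (c + d) = ext_const c + (ext_const d :: ('i::{finite,linorder}, 'a::comm_ring_1) ext_alg)"
  "ext_const (- c) = - (ext_const c :: ('i::{finite,linorder}, 'a::comm_ring_1) ext_alg)"
  "ext_const (c * d) = ext_const c * (ext_const d :: ('i::{finite,linorder}, 'a::comm_ring_1) ext_alg)"
  by (rule ext_alg_eqI, simp add: one_ext_alg_def)+

definition ext_monom :: "'i set \<Rightarrow> ('i, 'a::comm_ring_1) ext_alg" where
  "ext_monom T = Ext (\<lambda>U. if U = T then 1 else 0)"

lemma ext_monom_empty: "ext_monom {} = (1 :: ('i::{finite,linorder}, 'a::comm_ring_1) ext_alg)"
  by (simp add: ext_monom_def one_ext_alg_def)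

lemma ext_monom_singleton: "ext_monom {i} = ext_gen i"
  by (simp add: ext_monom_def ext_gen_def)

lemma ext_expansion:
  fixes r :: "('i::{finite,linorder}, 'a::comm_ring_1) ext_alg"
  shows "r = (\<Sum>T\<in>UNIV. ext_const (ext_coeff r T) * ext_monom T)"
  by (rule ext_alg_eqI) (simp add: ext_coeff_sum ext_monom_def if_distrib sum.delta cong: if_cong)

lemma ext_monom_mult:
  "ext_monom S * ext_monom T = (if S \<inter> T = {} then ext_const (ext_sign S T) * ext_monom (S \<union> T)
     else (0 :: ('i::{finite,linorder}, 'a::comm_ring_1) ext_alg))"
proof (rule ext_alg_eqI)
  fix U
  have "ext_coeff (ext_monom S * ext_monom T :: ('i, 'a) ext_alg) U =
      (\<Sum>V\<in>Pow U. if V = S then (if U - S = T then ext_sign S T else 0) else 0)"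
    unfolding times_ext_alg_def ext_monom_def ext_coeff_Ext by (intro sum.cong) auto
  also have "\<dots> = (if S \<inter> T = {} \<and> U = S \<union> T then ext_sign S T else 0)"
    by auto
  finally show "ext_coeff (ext_monom S * ext_monom T :: ('i, 'a) ext_alg) U =
      ext_coeff (if S \<inter> T = {} then ext_const (ext_sign S T) * ext_monom (S \<union> T) else 0) U"
    by (auto simp: ext_monom_def)
qed

lemma ext_gen_square: "ext_gen i * ext_gen i = (0 :: ('i::{finite,linorder}, 'a::comm_ring_1) ext_alg)"
  by (simp add: ext_monom_singleton[symmetric] ext_monom_mult)

lemma ext_gen_anticommute:
  "ext_gen i * ext_gen j = - (ext_gen j * (ext_gen i :: ('i::{finite,linorder}, 'a::comm_ring_1) ext_alg))"
proof -
  have "(ext_sign {i} {j} :: 'a) = - ext_sign {j} {i}" if "i \<noteq> j"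
    using that by (auto simp: ext_sign_singletons)
  then show ?thesis
    by (cases "i = j")
      (auto simp: ext_monom_singleton[symmetric] ext_monom_mult ext_const_hom insert_commute)
qed


definition ordered_prod :: "('i::{finite,linorder} \<Rightarrow> 'b::ring_1) \<Rightarrow> 'i set \<Rightarrow> 'b" where
  "ordered_prod b T = prod_list (map b (sorted_list_of_set T))"

lemma ordered_prod_empty [simp]: "ordered_prod b {} = 1"
  by (simp add: ordered_prod_def)

lemma ordered_prod_insert_min:
  assumes "\<And>t. t \<in> T \<Longrightarrow> m < t"
  shows "ordered_prod b (insert m T) = b m * ordered_prod b T"
proof -
  have "m \<notin> T" using assms by blast
  have "sorted_list_of_set (insert m T) = m # sorted_list_of_set T"
    using assms \<open>m \<notin> T\<close>
    by (subst sorted_list_of_set_insert) (auto simp: insort_is_Cons less_imp_le)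
  then show ?thesis by (simp add: ordered_prod_def)
qed

lemma ext_const_left_commute:
  "r * (ext_const c * s) = ext_const c * (r * (s :: ('i::{finite,linorder}, 'a::comm_ring_1) ext_alg))"
  by (metis ext_const_central mult.assoc)

context
  fixes b :: "'i::{finite,linorder} \<Rightarrow> ('i, 'a::comm_ring_1) ext_alg"
  assumes anticommute: "\<And>i j. b i * b j = - (b j * b i)"
    and square: "\<And>i. b i * b i = 0"
begin

lemma gen_mult_ordered_prod:
  "b i * ordered_prod b T =
     (if i \<in> T then 0 else ext_const (ext_sign {i} T) * ordered_prod b (insert i T))"
proof (induction T arbitrary: i rule: finite_linorder_min_induct[OF finite])
  case 1
  show ?case using ordered_prod_insert_min[of "{}" i b] by (simp add: ext_const_hom)
next
  case (2 m T)
  have min: "\<And>t. t \<in> T \<Longrightarrow> m < t" using "2.hyps"(2) by blast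
  then have "m \<notin> T" by blast
  consider "i < m" | "i = m" | "m < i" by (rule linorder_less_linear[THEN disjE]) auto
  then show ?case
  proof cases
    case 1
    then have "i \<notin> insert m T" and less: "\<And>t. t \<in> insert m T \<Longrightarrow> i < t"
      using min less_trans by blast+
    have "{t \<in> insert m T. t < i} = {}" using less less_asym by blast
    then have "(ext_sign {i} (insert m T) :: 'a) = 1"
      by (simp only: ext_sign_singleton_left card.empty power_0)
    then show ?thesis
      using \<open>i \<notin> insert m T\<close> ordered_prod_insert_min[of "insert m T" i b, OF less]
      by (simp add: ext_const_hom)
  next
    case 2
    then show ?thesis
      by (simp add: ordered_prod_insert_min[OF min] mult.assoc[symmetric] square)
  next
    case 3
    have "b i * ordered_prod b (insert m T) = - (b m * (b i * ordered_prod b T))"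
      by (simp add: ordered_prod_insert_min[OF min] mult.assoc[symmetric] anticommute[of i m])
    also have "\<dots> = (if i \<in> T then 0 else
        - (ext_const (ext_sign {i} T) * (b m * ordered_prod b (insert i T))))"
      using "2.IH" by (auto simp: ext_const_left_commute)
    also have "\<dots> = (if i \<in> T then 0 else
        - (ext_const (ext_sign {i} T) * ordered_prod b (insert m (insert i T))))"
      using min 3 by (subst ordered_prod_insert_min[of "insert i T" m b]) auto
    finally have "b i * ordered_prod b (insert m T) = (if i \<in> T then 0 else
        - (ext_const (ext_sign {i} T) * ordered_prod b (insert m (insert i T))))" .
    moreover have "(ext_sign {i} (insert m T) :: 'a) = - ext_sign {i} T"
      using ext_sign_Un_right[of "{m}" T "{i}", where 'a = 'a] \<open>m \<notin> T\<close> 3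
      by (simp add: ext_sign_singletons)
    ultimately show ?thesis using 3
      by (auto simp: ext_const_hom insert_commute)
  qed
qed

lemma ordered_prod_mult:
  "ordered_prod b S * ordered_prod b T =
     (if S \<inter> T = {} then ext_const (ext_sign S T) * ordered_prod b (S \<union> T) else 0)"
proof (induction S rule: finite_linorder_min_induct[OF finite])
  case 1
  show ?case by (simp add: ext_const_hom)
next
  case (2 m S)
  have min: "\<And>t. t \<in> S \<Longrightarrow> m < t" using "2.hyps"(2) by blast
  then have "m \<notin> S" by blast
  have empty: "{t \<in> S. t < m} = {}" using min less_asym by blast
  have sign: "(ext_sign {m} (S \<union> T) :: 'a) = ext_sign {m} T"
  proof -
    have "{t \<in> S \<union> T. t < m} = {t \<in> T. t < m}" using empty by blast
    then show ?thesis by (simp only: ext_sign_singleton_left)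
  qed
  have "ordered_prod b (insert m S) * ordered_prod b T = b m * (ordered_prod b S * ordered_prod b T)"
    by (simp add: ordered_prod_insert_min[OF min] mult.assoc)
  also have "\<dots> = (if S \<inter> T = {} then
      ext_const (ext_sign S T) * (b m * ordered_prod b (S \<union> T)) else 0)"
    by (simp add: "2.IH" ext_const_left_commute)
  also have "\<dots> = (if insert m S \<inter> T = {} then
      ext_const (ext_sign S T * ext_sign {m} T) * ordered_prod b (insert m S \<union> T) else 0)"
    using \<open>m \<notin> S\<close> by (auto simp: gen_mult_ordered_prod sign ext_const_hom mult.assoc)
  also have "(ext_sign S T * ext_sign {m} T :: 'a) = ext_sign (insert m S) T"
    using ext_sign_Un_left[of "{m}" S T, where 'a = 'a] \<open>m \<notin> S\<close> by (simp add: mult.commute)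
  finally show ?case .
qed

end

lemma ext_monom_eq_ordered_prod:
  "ext_monom T = (ordered_prod ext_gen T :: ('i::{finite,linorder}, 'a::comm_ring_1) ext_alg)"
proof (induction T rule: finite_linorder_min_induct[OF finite])
  case 1
  show ?case by (simp add: ext_monom_empty)
next
  case (2 m T)
  have min: "\<And>t. t \<in> T \<Longrightarrow> m < t" using "2.hyps"(2) by blast
  then have "m \<notin> T" and "{t \<in> T. t < m} = {}" using less_asym by blast+
  then have "(ext_sign {m} T :: 'a) = 1"
    by (simp only: ext_sign_singleton_left card.empty power_0)
  then show ?case
    using \<open>m \<notin> T\<close> ext_monom_mult[of "{m}" T, where 'a = 'a]
    by (simp add: ordered_prod_insert_min[OF min] "2.IH" ext_monom_singleton ext_const_hom)
qed


section \<open>Substitution into polynomials\<close>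

definition poly_subst :: "('i::finite \<Rightarrow> (('i \<Rightarrow>\<^sub>0 nat) \<Rightarrow>\<^sub>0 'a)) \<Rightarrow> (('i \<Rightarrow>\<^sub>0 nat) \<Rightarrow>\<^sub>0 'a) \<Rightarrow>
    (('i \<Rightarrow>\<^sub>0 nat) \<Rightarrow>\<^sub>0 'a::comm_ring_1)" where
  "poly_subst \<sigma> p = (\<Sum>m\<in>Poly_Mapping.keys p. Poly_Mapping.single 0 (Poly_Mapping.lookup p m) * (\<Prod>i\<in>UNIV. \<sigma> i ^ Poly_Mapping.lookup m i))"

lemma poly_mapping_sum_single: "p = (\<Sum>m\<in>Poly_Mapping.keys p. Poly_Mapping.single m (Poly_Mapping.lookup p m))"
  by (rule poly_mapping_eqI)
    (simp add: lookup_sum lookup_single when_def in_keys_iff if_distrib sum.delta cong: if_cong)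

lemma poly_subst_superset:
  assumes "finite K" "Poly_Mapping.keys p \<subseteq> K"
  shows "poly_subst \<sigma> p =
    (\<Sum>m\<in>K. Poly_Mapping.single 0 (Poly_Mapping.lookup p m) * (\<Prod>i\<in>UNIV. \<sigma> i ^ Poly_Mapping.lookup m i))"
  unfolding poly_subst_def using assms
  by (intro sum.mono_neutral_left) (auto simp: in_keys_iff)

lemma poly_subst_add: "poly_subst \<sigma> (p + q) = poly_subst \<sigma> p + poly_subst \<sigma> q"
proof -
  let ?K = "Poly_Mapping.keys p \<union> Poly_Mapping.keys q"
  have "Poly_Mapping.keys (p + q) \<subseteq> ?K" by (rule Poly_Mapping.keys_add)
  then show ?thesis
    by (simp add: poly_subst_superset[where K = ?K] lookup_add single_add distrib_right sum.distrib)
qed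

lemma poly_subst_zero [simp]: "poly_subst \<sigma> 0 = 0"
  by (simp add: poly_subst_def)

lemma poly_subst_sum: "poly_subst \<sigma> (sum f A) = (\<Sum>a\<in>A. poly_subst \<sigma> (f a))"
  by (induction A rule: infinite_finite_induct) (auto simp: poly_subst_add)

lemma poly_subst_single:
  "poly_subst \<sigma> (Poly_Mapping.single m c) = Poly_Mapping.single 0 c * (\<Prod>i\<in>UNIV. \<sigma> i ^ Poly_Mapping.lookup m i)"
  by (cases "c = 0") (simp_all add: poly_subst_def)

lemma poly_subst_mult: "poly_subst \<sigma> (p * q) = poly_subst \<sigma> p * poly_subst \<sigma> q"
proof -
  have single: "poly_subst \<sigma> (Poly_Mapping.single m c * Poly_Mapping.single n d) =
      poly_subst \<sigma> (Poly_Mapping.single m c) * poly_subst \<sigma> (Poly_Mapping.single n d)" for m n c d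
  proof -
    have "Poly_Mapping.single 0 (c * d) =
        Poly_Mapping.single 0 c * (Poly_Mapping.single 0 d :: ('a \<Rightarrow>\<^sub>0 nat) \<Rightarrow>\<^sub>0 'b)"
      by (simp add: mult_single)
    then show ?thesis
      unfolding mult_single[of m c] poly_subst_single
      by (simp only: lookup_add power_add prod.distrib mult_ac)
  qed
  have "p * q = (\<Sum>m\<in>Poly_Mapping.keys p. \<Sum>n\<in>Poly_Mapping.keys q.
      Poly_Mapping.single m (Poly_Mapping.lookup p m) * Poly_Mapping.single n (Poly_Mapping.lookup q n))"
    by (subst poly_mapping_sum_single[of p], subst poly_mapping_sum_single[of q])
      (simp add: sum_product)
  then have "poly_subst \<sigma> (p * q) = (\<Sum>m\<in>Poly_Mapping.keys p. \<Sum>n\<in>Poly_Mapping.keys q.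
      poly_subst \<sigma> (Poly_Mapping.single m (Poly_Mapping.lookup p m)) *
      poly_subst \<sigma> (Poly_Mapping.single n (Poly_Mapping.lookup q n)))"
    by (simp add: poly_subst_sum single)
  also have "\<dots> = poly_subst \<sigma> (\<Sum>m\<in>Poly_Mapping.keys p. Poly_Mapping.single m (Poly_Mapping.lookup p m)) *
      poly_subst \<sigma> (\<Sum>n\<in>Poly_Mapping.keys q. Poly_Mapping.single n (Poly_Mapping.lookup q n))"
    by (simp add: poly_subst_sum sum_product)
  finally show ?thesis
    by (simp add: poly_mapping_sum_single[symmetric])
qed

lemma poly_subst_const [simp]: "poly_subst \<sigma> (Poly_Mapping.single 0 c) = Poly_Mapping.single 0 c"
  by (simp add: poly_subst_single)

lemma poly_subst_gen: "poly_subst \<sigma> (Poly_Mapping.single (Poly_Mapping.single i 1) 1) = \<sigma> i"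
proof -
  have "(\<Prod>j\<in>UNIV. \<sigma> j ^ Poly_Mapping.lookup (Poly_Mapping.single i 1) j) = (\<Prod>j\<in>UNIV. if j = i then \<sigma> i else 1)"
    by (intro prod.cong) (auto simp: lookup_single when_def)
  then show ?thesis by (simp add: poly_subst_single)
qed

lemma poly_subst_ext_sign: "poly_subst \<sigma> (ext_sign S T) = ext_sign S T"
proof -
  have "(ext_sign S T :: ('a \<Rightarrow>\<^sub>0 nat) \<Rightarrow>\<^sub>0 'b) = Poly_Mapping.single 0 (ext_sign S T)"
  proof -
    have "((-1) ^ n :: ('a \<Rightarrow>\<^sub>0 nat) \<Rightarrow>\<^sub>0 'b) = Poly_Mapping.single 0 ((-1) ^ n)" for n
      by (induction n) (simp_all add: single_uminus)
    then show ?thesis by (simp add: ext_sign_def)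
  qed
  then show ?thesis by simp
qed

lemma poly_gens_generate:
  fixes p :: "('i::finite \<Rightarrow>\<^sub>0 nat) \<Rightarrow>\<^sub>0 'a::comm_ring_1"
  assumes const: "\<And>c. Poly_Mapping.single 0 c \<in> A"
    and gen: "\<And>i. Poly_Mapping.single (Poly_Mapping.single i 1) 1 \<in> A"
    and add: "\<And>p q. p \<in> A \<Longrightarrow> q \<in> A \<Longrightarrow> p + q \<in> A"
    and mult: "\<And>p q. p \<in> A \<Longrightarrow> q \<in> A \<Longrightarrow> p * q \<in> A"
  shows "p \<in> A"
proof -
  have one: "1 \<in> A" using const[of 1] by simp
  have zero: "0 \<in> A" using const[of 0] by simp
  have power: "Poly_Mapping.single (Poly_Mapping.single i n) 1 \<in> A" for i n
  proof (induction n)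
    case (Suc n)
    have "Poly_Mapping.single (Poly_Mapping.single i (Suc n)) (1::'a) =
        Poly_Mapping.single (Poly_Mapping.single i 1) 1 * Poly_Mapping.single (Poly_Mapping.single i n) 1"
      by (simp add: mult_single single_add[symmetric])
    then show ?case using mult[OF gen Suc] by simp
  qed (simp add: one)
  have monom: "Poly_Mapping.single (\<Sum>i\<in>F. Poly_Mapping.single i (m i)) 1 \<in> A" for F :: "'i set" and m
  proof (induction F rule: infinite_finite_induct)
    case (insert i F)
    then show ?case using mult[OF power[of i "m i"] insert.IH] by (simp add: mult_single)
  qed (simp_all add: one)
  have "Poly_Mapping.single m c \<in> A" for m c
  proof -
    have "(\<Sum>i\<in>UNIV. Poly_Mapping.single i (Poly_Mapping.lookup m i)) = m"
      by (rule poly_mapping_eqI)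
        (simp add: lookup_sum lookup_single when_def if_distrib sum.delta cong: if_cong)
    then show ?thesis
      using mult[OF const[of c] monom[of "Poly_Mapping.lookup m" UNIV]] by (simp add: mult_single)
  qed
  then have "(\<Sum>m\<in>K. Poly_Mapping.single m (Poly_Mapping.lookup p m)) \<in> A" for K
    by (induction K rule: infinite_finite_induct) (simp_all add: zero add)
  then show ?thesis by (subst poly_mapping_sum_single)
qed


section \<open>The algebra \<open>S(M\<^sup>*) \<otimes> \<Lambda>(M\<^sup>*)\<close>\<close>

text \<open>
  The numeral type \<open>3\<close> is the ring of integers modulo 3. It also serves as the index
  type \<open>{1, 2, 3}\<close>; there \<open>3 = 0\<close> is the least element, which only affects the choice of the
  basis monomials in the representation above.
\<close>

type_synonym F3 = "3"

lemma F3_field: "a \<noteq> 0 \<Longrightarrow> a * a = (1::F3)"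
  using exhaust_3[of a] by auto

text \<open>
  \<open>S \<otimes> \<Lambda>\<close> over the base field is the exterior algebra over the polynomial ring \<open>S\<close>.
\<close>

type_synonym sym_alg = "(3 \<Rightarrow>\<^sub>0 nat) \<Rightarrow>\<^sub>0 F3"
type_synonym sym_ext_alg = "(3, sym_alg) ext_alg"

definition scalar :: "F3 \<Rightarrow> sym_ext_alg" where
  "scalar c = ext_const (Poly_Mapping.single 0 c)"

definition X :: "3 \<Rightarrow> sym_ext_alg" where
  "X i = ext_const (Poly_Mapping.single (Poly_Mapping.single i 1) 1)"

definition Y :: "3 \<Rightarrow> sym_ext_alg" where
  "Y i = ext_gen i"

lemma X_central: "X i * r = r * X i"
  by (simp add: X_def ext_const_central)

lemma Y_anticommute: "Y i * Y j = - (Y j * Y i)" and Y_square: "Y i * Y i = 0"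
  unfolding Y_def by (rule ext_gen_anticommute, rule ext_gen_square)

definition subalgebra :: "sym_ext_alg set \<Rightarrow> bool" where
  "subalgebra A \<longleftrightarrow> (\<forall>c. scalar c \<in> A) \<and> (\<forall>r\<in>A. \<forall>s\<in>A. r + s \<in> A \<and> r * s \<in> A)"

definition minimally_generated :: "sym_ext_alg set \<Rightarrow> sym_ext_alg set \<Rightarrow> bool" where
  "minimally_generated A B \<longleftrightarrow> subalgebra hull B = A \<and> (\<forall>C. C \<subset> B \<longrightarrow> subalgebra hull C \<noteq> A)"

lemma subalgebra_hull: "subalgebra (subalgebra hull B)"
  by (rule hull_in) (auto simp: subalgebra_def)

definition alg_hom :: "(sym_ext_alg \<Rightarrow> sym_ext_alg) \<Rightarrow> bool" where
  "alg_hom \<phi> \<longleftrightarrow> (\<forall>c. \<phi> (scalar c) = scalar c) \<and>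
     (\<forall>r s. \<phi> (r + s) = \<phi> r + \<phi> s) \<and> (\<forall>r s. \<phi> (r * s) = \<phi> r * \<phi> s)"

lemma subalgebra_UNIV_if_gens:
  assumes A: "subalgebra A" and X: "\<And>i. X i \<in> A" and Y: "\<And>i. Y i \<in> A"
  shows "A = UNIV"
proof -
  have add: "r + s \<in> A" and mult: "r * s \<in> A" if "r \<in> A" "s \<in> A" for r s
    using A that by (auto simp: subalgebra_def)
  have scalar: "scalar c \<in> A" for c using A by (simp add: subalgebra_def)
  have zero: "0 \<in> A" and one: "1 \<in> A"
    using scalar[of 0] scalar[of 1] by (simp_all add: scalar_def ext_const_hom)
  have poly: "p \<in> {p. ext_const p \<in> A}" for p
    by (rule poly_gens_generate)
      (use scalar X add mult in \<open>auto simp: scalar_def X_def ext_const_hom\<close>)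
  have "prod_list (map Y l) \<in> A" for l
    by (induction l) (simp_all add: one mult Y)
  then have monom: "ext_monom T \<in> A" for T
    by (simp add: ext_monom_eq_ordered_prod ordered_prod_def Y_def[abs_def, symmetric] flip: Y_def)
  have "(\<Sum>T\<in>K. ext_const (ext_coeff r T) * ext_monom T) \<in> A" for r K
    using poly by (induction K rule: infinite_finite_induct) (auto simp: zero add mult monom)
  then have "r \<in> A" for r by (subst ext_expansion)
  then show ?thesis by blast
qed

lemma alg_hom_eqI:
  assumes "alg_hom \<phi>" "alg_hom \<psi>" "\<And>i. \<phi> (X i) = \<psi> (X i)" "\<And>i. \<phi> (Y i) = \<psi> (Y i)"
  shows "\<phi> = \<psi>"
proof -
  have "{r. \<phi> r = \<psi> r} = UNIV"
    by (rule subalgebra_UNIV_if_gens) (use assms in \<open>auto simp: subalgebra_def alg_hom_def\<close>)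
  then show ?thesis by auto
qed

lemma alg_hom_exists:
  fixes b :: "3 \<Rightarrow> sym_ext_alg" and \<sigma> :: "3 \<Rightarrow> sym_alg"
  assumes anticommute: "\<And>i j. b i * b j = - (b j * b i)" and square: "\<And>i. b i * b i = 0"
  shows "\<exists>\<phi>. alg_hom \<phi> \<and> (\<forall>i. \<phi> (X i) = ext_const (\<sigma> i)) \<and> (\<forall>i. \<phi> (Y i) = b i)"
proof -
  define \<phi> :: "sym_ext_alg \<Rightarrow> sym_ext_alg" where "\<phi> r = (\<Sum>T\<in>UNIV. ext_const (poly_subst \<sigma> (ext_coeff r T)) * ordered_prod b T)" for r
  have const: "\<phi> (ext_const p) = ext_const (poly_subst \<sigma> p)" for p
  proof -
    have "\<phi> (ext_const p) = (\<Sum>T::3 set\<in>UNIV. if T = {} then ext_const (poly_subst \<sigma> p) else 0)"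
      unfolding \<phi>_def by (intro sum.cong) (auto simp: ext_const_hom)
    then show ?thesis by simp
  qed
  have gen: "\<phi> (Y i) = b i" for i
  proof -
    have "ordered_prod b {i} = b i" by (simp add: ordered_prod_def)
    then have "\<phi> (Y i) = (\<Sum>T\<in>UNIV. if T = {i} then b i else 0)"
      unfolding \<phi>_def Y_def ext_gen_def
      using poly_subst_const[of \<sigma> 1] by (intro sum.cong) (auto simp: ext_const_hom)
    then show ?thesis by simp
  qed
  have add: "\<phi> (r + s) = \<phi> r + \<phi> s" for r s
    by (simp add: \<phi>_def poly_subst_add ext_const_hom distrib_right sum.distrib)
  have mult: "\<phi> (r * s) = \<phi> r * \<phi> s" for r s
  proof -
    let ?c = "\<lambda>S T. ext_const (poly_subst \<sigma> (ext_coeff r S)) * ext_const (poly_subst \<sigma> (ext_coeff s T)) *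
      (ext_const (ext_sign S T) * ordered_prod b (S \<union> T))"
    have summand: "ext_const (t * p * q) * z = ext_const p * ext_const q * (ext_const t * z)"
      for t p q :: sym_alg and z :: sym_ext_alg
    proof -
      have "t * p * q = p * q * t" by (simp only: mult_ac)
      then show ?thesis by (simp only: ext_const_hom mult.assoc)
    qed
    have coeff: "ext_coeff (r * s) U =
        (\<Sum>S\<in>Pow U. ext_sign S (U - S) * ext_coeff r S * ext_coeff s (U - S))" for U
      by (simp add: times_ext_alg_def)
    have "\<phi> (r * s) = (\<Sum>U\<in>UNIV. \<Sum>S\<in>Pow U. ?c S (U - S))"
      unfolding \<phi>_def coeff
    proof (intro sum.cong refl)
      fix U :: "3 set"
      have "ext_const (poly_subst \<sigma> (\<Sum>S\<in>Pow U. ext_sign S (U - S) * ext_coeff r S * ext_coeff s (U - S))) =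
          (\<Sum>S\<in>Pow U. ext_const (ext_sign S (U - S) * poly_subst \<sigma> (ext_coeff r S) *
              poly_subst \<sigma> (ext_coeff s (U - S))) :: sym_ext_alg)"
        by (rule ext_alg_eqI) (simp add: ext_coeff_sum poly_subst_sum poly_subst_mult poly_subst_ext_sign)
      then show "ext_const (poly_subst \<sigma>
            (\<Sum>S\<in>Pow U. ext_sign S (U - S) * ext_coeff r S * ext_coeff s (U - S))) * ordered_prod b U =
          (\<Sum>S\<in>Pow U. ?c S (U - S))"
        by (simp only: sum_distrib_right) (auto intro!: sum.cong simp: Un_absorb1 summand)
    qed
    also have "\<dots> = (\<Sum>(U, S)\<in>(SIGMA U:UNIV. Pow U). ?c S (U - S))"
      by (rule sum.Sigma) auto
    also have "\<dots> = (\<Sum>(S, T)\<in>{(S, T). S \<inter> T = {}}. ?c S T)"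
      by (rule sum.reindex_bij_witness[where i = "\<lambda>(S, T). (S \<union> T, S)" and j = "\<lambda>(U, S). (S, U - S)"])
        auto
    also have "\<dots> = (\<Sum>(S, T)\<in>UNIV. if S \<inter> T = {} then ?c S T else 0)"
      by (rule sum.mono_neutral_cong_left) (auto split: if_splits)
    also have "\<dots> = (\<Sum>S\<in>UNIV. \<Sum>T\<in>UNIV. if S \<inter> T = {} then ?c S T else 0)"
      by (simp add: sum.cartesian_product)
    also have "\<dots> = \<phi> r * \<phi> s"
      unfolding \<phi>_def sum_product
    proof (intro sum.cong refl)
      fix S T :: "3 set"
      let ?a = "ext_const (poly_subst \<sigma> (ext_coeff r S)) :: sym_ext_alg"
        and ?d = "ext_const (poly_subst \<sigma> (ext_coeff s T)) :: sym_ext_alg"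
      have "?a * ordered_prod b S * (?d * ordered_prod b T) =
          ?a * ?d * (ordered_prod b S * ordered_prod b T)"
        by (simp only: mult.assoc ext_const_left_commute[of "ordered_prod b S"])
      then show "(if S \<inter> T = {} then ?c S T else 0) =
          ?a * ordered_prod b S * (?d * ordered_prod b T)"
        by (simp add: ordered_prod_mult[OF anticommute square])
    qed
    finally show ?thesis .
  qed
  have "alg_hom \<phi>"
    unfolding alg_hom_def using const add mult by (simp add: scalar_def)
  moreover have "\<phi> (X i) = ext_const (\<sigma> i)" for i
    using const poly_subst_gen[of \<sigma> i] by (simp add: X_def)
  ultimately show ?thesis using gen by blast
qed


section \<open>The conjugation action of \<open>SL\<^sub>2(\<bbbF>\<^sub>3)\<close>\<close>

definition SL2 :: "(F3^2^2) set" where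
  "SL2 = {g. det g = 1}"

definition M :: "(F3^2^2) set" where
  "M = {v. trace v = 0}"

definition basis_M :: "3 \<Rightarrow> F3^2^2" where
  "basis_M i =
    (if i = 1 then vector [vector [0, 1], vector [-1, 0]]
     else if i = 2 then vector [vector [-1, -1], vector [-1, 1]]
     else vector [vector [1, -1], vector [-1, -1]])"

definition dual_M :: "(F3^2^2 \<Rightarrow> F3) set" where
  "dual_M = {f. (\<forall>u\<in>M. \<forall>v\<in>M. f (u + v) = f u + f v) \<and>
     (\<forall>c. \<forall>v\<in>M. f (\<chi> i j. c * v $ i $ j) = c * f v)}"

definition conj_act :: "F3^2^2 \<Rightarrow> F3^2^2 \<Rightarrow> F3^2^2" where
  "conj_act g v = g ** v ** matrix_inv g"

definition dual_act :: "F3^2^2 \<Rightarrow> (F3^2^2 \<Rightarrow> F3) \<Rightarrow> (F3^2^2 \<Rightarrow> F3)" where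
  "dual_act g f = (\<lambda>v. f (conj_act (matrix_inv g) v))"

text \<open>
  The two inclusions of \<open>M\<^sup>*\<close>, in degree 2 and degree 1. As \<open>f = \<Sum>i. f(v\<^sub>i) v\<^sub>i\<^sup>*\<close>, they map the
  dual basis to \<open>X\<close> and \<open>Y\<close>. Only the restriction of \<open>f\<close> to \<^const>\<open>M\<close> matters.
\<close>

definition sym_incl :: "(F3^2^2 \<Rightarrow> F3) \<Rightarrow> sym_ext_alg" where
  "sym_incl f = (\<Sum>i\<in>UNIV. scalar (f (basis_M i)) * X i)"

definition ext_incl :: "(F3^2^2 \<Rightarrow> F3) \<Rightarrow> sym_ext_alg" where
  "ext_incl f = (\<Sum>i\<in>UNIV. scalar (f (basis_M i)) * Y i)"

definition extends_dual_act :: "F3^2^2 \<Rightarrow> (sym_ext_alg \<Rightarrow> sym_ext_alg) \<Rightarrow> bool" where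
  "extends_dual_act g \<phi> \<longleftrightarrow> alg_hom \<phi> \<and>
     (\<forall>f\<in>dual_M. \<phi> (sym_incl f) = sym_incl (dual_act g f) \<and> \<phi> (ext_incl f) = ext_incl (dual_act g f))"


subsection \<open>Existence and uniqueness of the extended action\<close>

lemma scalar_central: "scalar c * r = r * scalar c"
  by (simp add: scalar_def ext_const_central)

lemma scalar_left_commute: "r * (scalar c * s) = scalar c * (r * s)"
  by (simp add: scalar_def ext_const_left_commute)

lemma scalar_hom:
  "scalar 0 = 0" "scalar 1 = 1" "scalar (c + d) = scalar c + scalar d"
  "scalar (c * d) = scalar c * scalar d"
  by (simp_all add: scalar_def ext_const_hom single_add flip: ext_const_hom(5) add: mult_single)

lemma matrix_inv_eqI:
  fixes g h :: "F3^2^2"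
  assumes "g ** h = mat 1" "h ** g = mat 1"
  shows "matrix_inv g = h"
proof -
  have "g ** matrix_inv g = mat 1 \<and> matrix_inv g ** g = mat 1"
    unfolding matrix_inv_def by (rule someI[of _ h]) (use assms in simp)
  then show ?thesis using assms by (metis matrix_mul_assoc matrix_mul_lid matrix_mul_rid)
qed

lemma SL2_inverse:
  assumes "g \<in> SL2"
  shows "g ** matrix_inv g = mat 1" "matrix_inv g ** g = mat 1"
proof -
  let ?h = "vector [vector [g $ 2 $ 2, - g $ 1 $ 2], vector [- g $ 2 $ 1, g $ 1 $ 1]] :: F3^2^2"
  have "g $ 1 $ 1 * g $ 2 $ 2 - g $ 1 $ 2 * g $ 2 $ 1 = 1"
    using assms by (simp add: SL2_def det_2)
  then have "g ** ?h = mat 1" "?h ** g = mat 1"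
    by (simp_all add: vec_eq_iff forall_2 matrix_matrix_mult_def sum_2 mat_def algebra_simps)
  then show "g ** matrix_inv g = mat 1" "matrix_inv g ** g = mat 1"
    using matrix_inv_eqI[of g ?h] by simp_all
qed

lemma SL2_mult: "g \<in> SL2 \<Longrightarrow> h \<in> SL2 \<Longrightarrow> g ** h \<in> SL2"
  by (simp add: SL2_def det_mul)

lemma SL2_matrix_inv: "g \<in> SL2 \<Longrightarrow> matrix_inv g \<in> SL2"
  using SL2_inverse(1)[of g] det_mul[of g "matrix_inv g"] by (simp add: SL2_def)

lemma SL2_inverse_inverse: "g \<in> SL2 \<Longrightarrow> matrix_inv (matrix_inv g) = g"
  by (rule matrix_inv_eqI) (simp_all add: SL2_inverse)

lemma SL2_inverse_mult:
  assumes "g \<in> SL2" "h \<in> SL2"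
  shows "matrix_inv (g ** h) = matrix_inv h ** matrix_inv g"
  by (rule matrix_inv_eqI)
    (metis SL2_inverse assms matrix_mul_assoc matrix_mul_lid)+

lemma conj_act_M:
  assumes "g \<in> SL2" "v \<in> M"
  shows "conj_act g v \<in> M"
proof -
  have "trace (g ** v ** matrix_inv g) = trace (matrix_inv g ** (g ** v))"
    by (rule trace_mul_sym)
  also have "\<dots> = trace v"
    by (simp add: matrix_mul_assoc SL2_inverse assms)
  finally show ?thesis using assms by (simp add: M_def conj_act_def)
qed

lemma conj_act_mult:
  "g \<in> SL2 \<Longrightarrow> h \<in> SL2 \<Longrightarrow> conj_act (g ** h) v = conj_act g (conj_act h v)"
  by (simp add: conj_act_def SL2_inverse_mult matrix_mul_assoc)

lemma conj_act_add: "conj_act g (u + v) = conj_act g u + conj_act g v"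
  by (simp add: conj_act_def vec_eq_iff matrix_matrix_mult_def sum_2 algebra_simps)

lemma conj_act_scale:
  "conj_act g (\<chi> i j. c * v $ i $ j) = (\<chi> i j. c * conj_act g v $ i $ j)"
  by (simp add: conj_act_def vec_eq_iff matrix_matrix_mult_def sum_2 algebra_simps)

lemma dual_act_dual_M:
  assumes "g \<in> SL2" "f \<in> dual_M"
  shows "dual_act g f \<in> dual_M"
  using assms conj_act_M[OF SL2_matrix_inv[OF assms(1)]]
  by (simp add: dual_M_def dual_act_def conj_act_add conj_act_scale)

lemma dual_act_mult:
  "g \<in> SL2 \<Longrightarrow> h \<in> SL2 \<Longrightarrow> dual_act (g ** h) f = dual_act g (dual_act h f)"
  by (simp add: dual_act_def SL2_inverse_mult SL2_matrix_inv conj_act_mult)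

definition dual_basis_M :: "3 \<Rightarrow> F3^2^2 \<Rightarrow> F3" where
  "dual_basis_M i v =
    (if i = 1 then v $ 2 $ 1 - v $ 1 $ 2
     else if i = 2 then v $ 1 $ 1 - v $ 1 $ 2 - v $ 2 $ 1
     else - v $ 1 $ 1 - v $ 1 $ 2 - v $ 2 $ 1)"

lemma basis_M_in_M: "basis_M i \<in> M"
  by (simp add: basis_M_def M_def trace_def sum_2)

lemma dual_basis_M_in_dual_M: "dual_basis_M i \<in> dual_M"
  by (simp add: dual_M_def dual_basis_M_def algebra_simps)

lemma dual_basis_M_basis_M: "dual_basis_M i (basis_M j) = (if i = j then 1 else 0)"
  using exhaust_3[of i] exhaust_3[of j] by (auto simp: dual_basis_M_def basis_M_def)

lemma M_expansion:
  assumes "v \<in> M"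
  shows "v = (\<Sum>k\<in>UNIV. \<chi> i j. dual_basis_M k v * basis_M k $ i $ j)"
proof -
  have "v $ 2 $ 2 = - v $ 1 $ 1"
    using assms by (simp add: M_def trace_def sum_2 add_eq_0_iff)
  then show ?thesis
    using exhaust_3[of "v $ 1 $ 1"] exhaust_3[of "v $ 1 $ 2"] exhaust_3[of "v $ 2 $ 1"]
    by (auto simp: vec_eq_iff forall_2 sum_3 dual_basis_M_def basis_M_def)
qed

lemma dual_M_expansion:
  assumes f: "f \<in> dual_M" and v: "v \<in> M"
  shows "f v = (\<Sum>k\<in>UNIV. dual_basis_M k v * f (basis_M k))"
proof -
  have add: "f (u + w) = f u + f w" if "u \<in> M" "w \<in> M" for u w
    using f that by (simp add: dual_M_def)
  have scale: "f (\<chi> i j. c * w $ i $ j) = c * f w" if "w \<in> M" for c w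
    using f that by (simp add: dual_M_def)
  have M_add: "u + w \<in> M" if "u \<in> M" "w \<in> M" for u w
    using that by (simp add: M_def trace_add)
  have M_scale: "(\<chi> i j. c * w $ i $ j) \<in> M" if "w \<in> M" for c w
    using that by (simp add: M_def trace_def flip: sum_distrib_left)
  show ?thesis
    by (subst M_expansion[OF v])
      (simp add: sum_3 add scale M_add M_scale basis_M_in_M del: plus_vec_def)
qed

lemma sym_incl_dual_basis_M: "sym_incl (dual_basis_M i) = X i"
  unfolding sym_incl_def dual_basis_M_basis_M
  by (simp add: scalar_hom if_distrib if_distribR sum.delta cong: if_cong)

lemma ext_incl_dual_basis_M: "ext_incl (dual_basis_M i) = Y i"
  unfolding ext_incl_def dual_basis_M_basis_M
  by (simp add: scalar_hom if_distrib if_distribR sum.delta cong: if_cong)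

lemma ext_incl_anticommute: "ext_incl f * ext_incl h = - (ext_incl h * ext_incl f)"
proof -
  have "scalar c * Y i * (scalar d * Y j) = - (scalar d * Y j * (scalar c * Y i))" for c d i j
  proof -
    have "scalar c * Y i * (scalar d * Y j) = scalar c * (scalar d * (Y i * Y j))"
      by (simp add: mult.assoc scalar_left_commute[of "Y i"])
    also have "\<dots> = - (scalar d * (scalar c * (Y j * Y i)))"
      by (simp add: Y_anticommute[of i j] scalar_left_commute[of "scalar c"])
    also have "\<dots> = - (scalar d * Y j * (scalar c * Y i))"
      by (simp add: mult.assoc scalar_left_commute[of "Y j"])
    finally show ?thesis .
  qed
  then have "ext_incl f * ext_incl h = (\<Sum>i\<in>UNIV. \<Sum>j\<in>UNIV.
      - (scalar (h (basis_M j)) * Y j * (scalar (f (basis_M i)) * Y i)))"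
    unfolding ext_incl_def sum_product by (intro sum.cong refl)
  also have "\<dots> = - (\<Sum>i\<in>UNIV. \<Sum>j\<in>UNIV.
      scalar (h (basis_M j)) * Y j * (scalar (f (basis_M i)) * Y i))"
    by (simp only: sum_negf)
  also have "\<dots> = - (ext_incl h * ext_incl f)"
    unfolding ext_incl_def sum_product by (subst sum.swap) (rule refl)
  finally show ?thesis .
qed

lemma ext_incl_square: "ext_incl f * ext_incl f = 0"
proof -
  have "scalar 1 + scalar 1 + scalar 1 = scalar (1 + 1 + 1)" by (simp only: scalar_hom)
  moreover have "1 + 1 + 1 = (0 :: F3)" by simp
  ultimately have three: "1 + 1 + 1 = (0 :: sym_ext_alg)" by (simp only: scalar_hom)
  let ?r = "ext_incl f * ext_incl f"
  have "?r = (1 + 1 + 1) * ?r - (?r + ?r)"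
    by (simp only: distrib_right mult_1_left) simp
  also have "?r + ?r = 0"
    using ext_incl_anticommute[of f f] by (simp add: eq_neg_iff_add_eq_0)
  finally show ?thesis using three by simp
qed

lemma extends_dual_act_ex1:
  assumes g: "g \<in> SL2"
  shows "\<exists>!\<phi>. extends_dual_act g \<phi>"
proof -
  let ?d = "\<lambda>j. dual_act g (dual_basis_M j)"
  have "\<exists>\<sigma>. ext_const \<sigma> = sym_incl f" for f
    by (rule exI[of _ "\<Sum>i\<in>UNIV. Poly_Mapping.single 0 (f (basis_M i)) *
          Poly_Mapping.single (Poly_Mapping.single i 1) 1"])
      (simp add: sym_incl_def scalar_def X_def ext_const_hom sum_3)
  then have "\<forall>j. \<exists>\<sigma>. ext_const \<sigma> = sym_incl (?d j)" by blast
  from choice[OF this] obtain \<sigma> where \<sigma>: "\<And>j. ext_const (\<sigma> j) = sym_incl (?d j)"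
    by blast
  have "\<exists>\<phi>. alg_hom \<phi> \<and> (\<forall>j. \<phi> (X j) = ext_const (\<sigma> j)) \<and> (\<forall>j. \<phi> (Y j) = ext_incl (?d j))"
    by (rule alg_hom_exists) (rule ext_incl_anticommute, rule ext_incl_square)
  then obtain \<phi> where hom: "alg_hom \<phi>" and X: "\<And>j. \<phi> (X j) = sym_incl (?d j)"
    and Y: "\<And>j. \<phi> (Y j) = ext_incl (?d j)"
    unfolding \<sigma> by blast
  have linear: "\<phi> (scalar c * r) = scalar c * \<phi> r" "\<phi> (r + s) = \<phi> r + \<phi> s" for c r s
    using hom by (auto simp: alg_hom_def)
  have at_basis: "dual_act g f (basis_M i) = (\<Sum>j\<in>UNIV. ?d j (basis_M i) * f (basis_M j))"
    if "f \<in> dual_M" for f i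
    unfolding dual_act_def
    using that conj_act_M[OF SL2_matrix_inv[OF g] basis_M_in_M] by (rule dual_M_expansion)
  have comb: "(\<Sum>j\<in>UNIV. scalar (f (basis_M j)) * (\<Sum>i\<in>UNIV. scalar (?d j (basis_M i)) * Z i)) =
      (\<Sum>i\<in>UNIV. scalar (dual_act g f (basis_M i)) * Z i)"
    if "f \<in> dual_M" for f and Z :: "3 \<Rightarrow> sym_ext_alg"
  proof -
    have "(\<Sum>j\<in>UNIV. scalar (f (basis_M j)) * (\<Sum>i\<in>UNIV. scalar (?d j (basis_M i)) * Z i)) =
        (\<Sum>j\<in>UNIV. \<Sum>i\<in>UNIV. scalar (?d j (basis_M i) * f (basis_M j)) * Z i)"
      unfolding sum_distrib_left scalar_hom(4) mult.assoc
      by (intro sum.cong refl scalar_left_commute)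
    also have "\<dots> = (\<Sum>i\<in>UNIV. \<Sum>j\<in>UNIV. scalar (?d j (basis_M i) * f (basis_M j)) * Z i)"
      by (rule sum.swap)
    also have "\<dots> = (\<Sum>i\<in>UNIV. scalar (\<Sum>j\<in>UNIV. ?d j (basis_M i) * f (basis_M j)) * Z i)"
      by (simp only: sum_3 scalar_hom(3) distrib_right)
    also have "\<dots> = (\<Sum>i\<in>UNIV. scalar (dual_act g f (basis_M i)) * Z i)"
      by (simp only: at_basis[OF that])
    finally show ?thesis .
  qed
  have "extends_dual_act g \<phi>"
    unfolding extends_dual_act_def
  proof (intro conjI ballI hom)
    fix f assume f: "f \<in> dual_M"
    show "\<phi> (sym_incl f) = sym_incl (dual_act g f)"
    proof -
      have "\<phi> (sym_incl f) = (\<Sum>j\<in>UNIV. scalar (f (basis_M j)) * \<phi> (X j))"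
        unfolding sym_incl_def by (simp only: sum_3 linear)
      then show ?thesis
        unfolding X unfolding sym_incl_def comb[OF f] .
    qed
    show "\<phi> (ext_incl f) = ext_incl (dual_act g f)"
    proof -
      have "\<phi> (ext_incl f) = (\<Sum>j\<in>UNIV. scalar (f (basis_M j)) * \<phi> (Y j))"
        unfolding ext_incl_def by (simp only: sum_3 linear)
      then show ?thesis
        unfolding Y unfolding ext_incl_def comb[OF f] .
    qed
  qed
  then show ?thesis
  proof (rule ex1I[of "extends_dual_act g"])
    fix \<psi> assume \<psi>: "extends_dual_act g \<psi>"
    show "\<psi> = \<phi>"
    proof (rule alg_hom_eqI)
      show "\<psi> (X i) = \<phi> (X i)" for i
        using \<psi> dual_basis_M_in_dual_M[of i] X[of i]
        by (metis extends_dual_act_def sym_incl_dual_basis_M)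
      show "\<psi> (Y i) = \<phi> (Y i)" for i
        using \<psi> dual_basis_M_in_dual_M[of i] Y[of i]
        by (metis extends_dual_act_def ext_incl_dual_basis_M)
    qed (use \<psi> hom in \<open>auto simp: extends_dual_act_def\<close>)
  qed
qed

definition act :: "F3^2^2 \<Rightarrow> sym_ext_alg \<Rightarrow> sym_ext_alg" where
  "act g = (THE \<phi>. extends_dual_act g \<phi>)"

definition invariants :: "sym_ext_alg set" where
  "invariants = {r. \<forall>g\<in>SL2. act g r = r}"


lemma act_extends: "g \<in> SL2 \<Longrightarrow> extends_dual_act g (act g)"
  unfolding act_def using theI'[OF extends_dual_act_ex1] .

lemma act_mult:
  assumes "g \<in> SL2" "h \<in> SL2"
  shows "act (g ** h) r = act g (act h r)"
proof -
  have "extends_dual_act (g ** h) (\<lambda>r. act g (act h r))"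
    using act_extends[OF assms(1)] act_extends[OF assms(2)] assms
    by (simp add: extends_dual_act_def alg_hom_def dual_act_mult dual_act_dual_M)
  then have "act (g ** h) = (\<lambda>r. act g (act h r))"
    using extends_dual_act_ex1 act_extends SL2_mult assms by blast
  then show ?thesis by simp
qed

lemma act_one: "act (mat 1) r = r"
proof -
  have "mat 1 \<in> SL2" by (simp add: SL2_def)
  moreover have "dual_act (mat 1) f = f" for f
    using matrix_inv_eqI[of "mat 1" "mat 1"] by (simp add: dual_act_def conj_act_def)
  then have "extends_dual_act (mat 1) (\<lambda>r. r)"
    by (simp add: extends_dual_act_def alg_hom_def)
  ultimately have "act (mat 1) = (\<lambda>r. r)"
    using extends_dual_act_ex1 act_extends by blast
  then show ?thesis by simp
qed

end

theory Submission
  imports Defs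
begin

text \<open>
  The group acts through \<open>A\<^sub>4\<close>, generated by the cyclic permutation \<open>\<rho>\<close> of the coordinates and the sign
  changes of two coordinates. Hence an invariant is determined by its coefficients at \<open>1\<close>, \<open>y\<^sub>1\<close>,
  \<open>y\<^sub>2 y\<^sub>3\<close>, \<open>y\<^sub>1 y\<^sub>2 y\<^sub>3\<close>: the first and the last are \<open>A\<^sub>4\<close>-invariant polynomials, the middle two
  are arbitrary polynomials \<open>f\<close> having the sign character of \<open>x\<^sub>1\<close>. Put \<open>u\<^sub>i = x\<^sub>i\<^sup>2\<close>. Artin's basis of
  \<open>\<bbbF>\<^sub>3[u\<^sub>1, u\<^sub>2, u\<^sub>3]\<close> over the symmetric polynomials shows that the invariant polynomials are generated by
  \<open>a\<^sub>1, a\<^sub>2, a\<^sub>3, b\<close>, as they are spanned by \<open>\<rho>\<close>-orbit sums and powers of \<open>a\<^sub>2\<close>, and that the polynomials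
  \<open>f\<close> are spanned by \<open>x\<^sub>1, x\<^sub>2 x\<^sub>3, x\<^sub>1\<^sup>3, x\<^sub>1 x\<^sub>2\<^sup>2, x\<^sub>2\<^sup>3 x\<^sub>3, x\<^sub>1\<^sup>3 x\<^sub>2\<^sup>2\<close> over \<open>\<bbbF>\<^sub>3[a\<^sub>1, a\<^sub>2, a\<^sub>3]\<close>. In exterior degree 1
  these are the \<open>c\<^sub>i\<close>; in exterior degree 2 the first three are the \<open>d\<^sub>i\<close> and the others come from
  products \<open>c\<^sub>i c\<^sub>j\<close>. For minimality, each generator is detected by a linear functional that is a
  derivation along the augmentation and kills all other generators.
\<close>

section \<open>Coefficients of polynomials in three variables\<close>

text \<open>The order of the type \<open>3\<close> is that of the residues 0, 1, 2, so
  \<open>3\<close> is the least index. The signs in products of the \<open>Y i\<close> are computed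
  from these comparisons.\<close>

lemma F3_less: "(1::3) < 2" "\<not> (2::3) < 1" "(3::3) < 1" "(3::3) < 2"  "\<not> (1::3) < 3" "\<not> (2::3) < 3"
  by (simp_all add: less_bit1_def bit1.Rep_numeral bit1.Rep_1 bit1.Rep_0)

definition expo :: "nat \<Rightarrow> nat \<Rightarrow> nat \<Rightarrow> 3 \<Rightarrow>\<^sub>0 nat" where
  "expo i j k = Poly_Mapping.single 1 i + Poly_Mapping.single 2 j + Poly_Mapping.single 3 k"

lemma lookup_expo [simp]:
  "Poly_Mapping.lookup (expo i j k) 1 = i" "Poly_Mapping.lookup (expo i j k) 2 = j"
  "Poly_Mapping.lookup (expo i j k) 3 = k" "Poly_Mapping.lookup (expo i j k) 0 = k"
  by (simp_all add: expo_def lookup_add lookup_single)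

lemma expo_eq_iff [simp]: "expo i j k = expo a b c \<longleftrightarrow> i = a \<and> j = b \<and> k = c"
  by (metis lookup_expo)

lemma expo_add: "expo i j k + expo a b c = expo (i + a) (j + b) (k + c)"
  by (simp add: expo_def single_add ac_simps)

lemma expo_zero: "expo 0 0 0 = 0"
  by (simp add: expo_def)

lemma expo_cases: obtains i j k where "m = expo i j k"
proof -
  have "m = expo (Poly_Mapping.lookup m 1) (Poly_Mapping.lookup m 2) (Poly_Mapping.lookup m 3)"
  proof (rule poly_mapping_eqI)
    fix l :: 3
    show "Poly_Mapping.lookup m l = Poly_Mapping.lookup (expo (Poly_Mapping.lookup m 1)
      (Poly_Mapping.lookup m 2) (Poly_Mapping.lookup m 3)) l"
      using exhaust_3[of l] lookup_expo by metis
  qed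
  then show ?thesis by (rule that)
qed

definition cf :: "sym_alg \<Rightarrow> nat \<Rightarrow> nat \<Rightarrow> nat \<Rightarrow> F3" where
  "cf p i j k = Poly_Mapping.lookup p (expo i j k)"

lemma cf_eqI: "(\<And>i j k. cf p i j k = cf q i j k) \<Longrightarrow> p = q"
  by (rule poly_mapping_eqI) (metis cf_def expo_cases)

lemma cf_simps [simp]:
  "cf 0 i j k = 0" "cf (p + q) i j k = cf p i j k + cf q i j k"
  "cf (- p) i j k = - cf p i j k" "cf (p - q) i j k = cf p i j k - cf q i j k"
  by (simp_all add: cf_def lookup_add lookup_minus)

lemma cf_single:
  "cf (Poly_Mapping.single (expo a b c) v) i j k = (if a = i \<and> b = j \<and> c = k then v else 0)"
  by (simp add: cf_def lookup_single when_def)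

text \<open>The coefficient may be zero, so \<open>monom\<close> also covers the zero
  polynomial.\<close>

lemma poly_induct [case_names monom add]:
  assumes "\<And>i j k c. P (Poly_Mapping.single (expo i j k) c)" "\<And>p q. P p \<Longrightarrow> P q \<Longrightarrow> P (p + q)"
  shows "P (p :: sym_alg)"
proof -
  have single: "P (Poly_Mapping.single m c)" for m c
    using assms(1) by (metis expo_cases)
  have "P (\<Sum>m\<in>K. Poly_Mapping.single m (Poly_Mapping.lookup p m))" for K
    by (induction K rule: infinite_finite_induct)
      (use single[of 0 0] single assms(2) in auto)
  then show ?thesis by (subst poly_mapping_sum_single)
qed

lemma cf_monom_mult:
  "cf (Poly_Mapping.single (expo a b c) v * q) i j k =
    (if a \<le> i \<and> b \<le> j \<and> c \<le> k then v * cf q (i - a) (j - b) (k - c) else 0)"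
  by (induction q rule: poly_induct) (auto simp: mult_single expo_add cf_single algebra_simps)

lemma cf_mult:
  "cf (p * q) i j k = (\<Sum>a\<le>i. \<Sum>b\<le>j. \<Sum>c\<le>k. cf p a b c * cf q (i - a) (j - b) (k - c))"
proof (induction p rule: poly_induct)
  case (monom a b c v)
  \<comment> \<open>Nested conditions let each of the three sums collapse separately to the single
    index that contributes.\<close>
  have delta: "(if a = a' \<and> b = b' \<and> c = c' then v else 0) * z =
      (if a' = a then if b' = b then if c' = c then v * z else 0 else 0 else 0)" for a' b' c' z
    by simp
  have pull: "(\<Sum>x\<in>A. if Q then f x else 0) = (if Q then sum f A else 0)"
    for A :: "nat set" and Q and f :: "nat \<Rightarrow> F3"
    by simp
  show ?case unfolding cf_single delta pull by (simp add: cf_monom_mult)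
qed (simp add: distrib_right sum.distrib)

section \<open>The variables and the two substitutions\<close>

definition "x\<^sub>1 = (Poly_Mapping.single (expo 1 0 0) 1 :: sym_alg)"
definition "x\<^sub>2 = (Poly_Mapping.single (expo 0 1 0) 1 :: sym_alg)"
definition "x\<^sub>3 = (Poly_Mapping.single (expo 0 0 1) 1 :: sym_alg)"

lemma x_powers: "x\<^sub>1 ^ i * x\<^sub>2 ^ j * x\<^sub>3 ^ k = Poly_Mapping.single (expo i j k) 1"
proof -
  have "x\<^sub>1 ^ i = Poly_Mapping.single (expo i 0 0) 1" "x\<^sub>2 ^ i = Poly_Mapping.single (expo 0 i 0) 1"
     "x\<^sub>3 ^ i = Poly_Mapping.single (expo 0 0 i) 1" for i
    by (induction i) (simp_all add: expo_zero x\<^sub>1_def x\<^sub>2_def x\<^sub>3_def mult_single expo_add)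
  then show ?thesis by (simp add: mult_single expo_add)
qed

lemma X_eq: "X 1 = ext_const x\<^sub>1" "X 2 = ext_const x\<^sub>2" "X 3 = ext_const x\<^sub>3"
  by (simp_all add: X_def x\<^sub>1_def x\<^sub>2_def x\<^sub>3_def expo_def)

lemma char_3: "p + p + p = (0 :: sym_alg)"
proof (rule cf_eqI)
  fix i j k
  have "c + c + c = 0" for c :: F3 using exhaust_3[of c] by auto
  from this[of "cf p i j k"] show "cf (p + p + p) i j k = cf 0 i j k"
    unfolding cf_simps .
qed

text \<open>\<open>\<rho>\<close> and the following \<open>\<tau>\<close> are the automorphisms by
  which \<open>gU\<close> and \<open>gS\<close> will be seen to act on polynomials, in
  \<open>act_const\<close>.\<close>

definition "\<rho> = (poly_subst (\<lambda>i. if i = 1 then x\<^sub>2 else if i = 2 then x\<^sub>3 else x\<^sub>1) :: sym_alg \<Rightarrow> sym_alg)"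

definition "\<tau> = (poly_subst (\<lambda>i. if i = 1 then x\<^sub>1 else if i = 2 then - x\<^sub>2 else - x\<^sub>3) :: sym_alg \<Rightarrow> sym_alg)"

lemma poly_subst_x: "poly_subst \<sigma> x\<^sub>1 = \<sigma> 1" "poly_subst \<sigma> x\<^sub>2 = \<sigma> 2" "poly_subst \<sigma> x\<^sub>3 = \<sigma> 3"
  using poly_subst_gen[of \<sigma>] by (simp_all add: x\<^sub>1_def x\<^sub>2_def x\<^sub>3_def expo_def)

lemma prod_3: "(\<Prod>i\<in>UNIV. f (i::3)) = f 1 * f 2 * f 3"
  unfolding UNIV_3 by (simp add: mult.assoc)

lemma poly_subst_monom:
  "poly_subst \<sigma> (Poly_Mapping.single (expo a b c) v) = Poly_Mapping.single 0 v * (\<sigma> 1 ^ a * \<sigma> 2 ^ b * \<sigma> 3 ^ c)"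
  unfolding poly_subst_single prod_3 lookup_expo ..

lemma rho_hom [simp]: "\<rho> (p + q) = \<rho> p + \<rho> q" "\<rho> (p * q) = \<rho> p * \<rho> q" "\<rho> 0 = 0"
  "\<rho> (Poly_Mapping.single 0 c) = Poly_Mapping.single 0 c"
  "\<rho> x\<^sub>1 = x\<^sub>2" "\<rho> x\<^sub>2 = x\<^sub>3" "\<rho> x\<^sub>3 = x\<^sub>1"
  by (simp_all add: \<rho>_def poly_subst_add poly_subst_mult poly_subst_x)

lemma cf_rho [simp]: "cf (\<rho> p) i j k = cf p j k i"
proof (induction p rule: poly_induct)
  case (monom a b c v)
  have "\<rho> (Poly_Mapping.single (expo a b c) v) = Poly_Mapping.single 0 v * (x\<^sub>1 ^ c * x\<^sub>2 ^ a * x\<^sub>3 ^ b)"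
    by (simp add: \<rho>_def poly_subst_monom mult_ac)
  then show ?case by (auto simp: x_powers mult_single cf_single)
qed simp

lemma cf_tau: "cf (\<tau> p) i j k = (-1) ^ (j + k) * cf p i j k"
proof (induction p rule: poly_induct)
  case (monom a b c v)
  have "\<tau> (Poly_Mapping.single (expo a b c) v) = Poly_Mapping.single 0 v * (x\<^sub>1 ^ a * (- x\<^sub>2) ^ b * (- x\<^sub>3) ^ c)"
    by (simp add: \<tau>_def poly_subst_monom)
  also have "\<dots> = (-1) ^ (b + c) * Poly_Mapping.single 0 v * (x\<^sub>1 ^ a * x\<^sub>2 ^ b * x\<^sub>3 ^ c)"
    by (simp add: power_minus[of x\<^sub>2] power_minus[of x\<^sub>3] power_add)
  also have "\<dots> = (-1) ^ (b + c) * Poly_Mapping.single (expo a b c) v"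
    unfolding x_powers by (simp add: mult.assoc mult_single)
  finally have 1: "\<tau> (Poly_Mapping.single (expo a b c) v) = (-1) ^ (b + c) * Poly_Mapping.single (expo a b c) v" .
  have "even (b + c) \<or> odd (b + c)" by blast
  with 1 show ?case by (auto simp: cf_single simp del: power_add)
qed (simp add: \<tau>_def poly_subst_add distrib_left)

section \<open>The eight components of an element\<close>

text \<open>
  As \<open>3 = 0\<close> is the least index, the basis monomials of degree 2 are \<open>y\<^sub>3 y\<^sub>1\<close>, \<open>y\<^sub>1 y\<^sub>2\<close>
  and \<open>y\<^sub>3 y\<^sub>2 = - y\<^sub>2 y\<^sub>3\<close>; hence the sign in \<open>co23\<close>.
\<close>

definition "co0 r = ext_coeff r ({} :: 3 set)" for r :: sym_ext_alg
definition "co1 r = ext_coeff r {1 :: 3}" for r :: sym_ext_alg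
definition "co2 r = ext_coeff r {2 :: 3}" for r :: sym_ext_alg
definition "co3 r = ext_coeff r {3 :: 3}" for r :: sym_ext_alg
definition "co23 r = - ext_coeff r {3 :: 3, 2}" for r :: sym_ext_alg
definition "co31 r = ext_coeff r {3 :: 3, 1}" for r :: sym_ext_alg
definition "co12 r = ext_coeff r {1 :: 3, 2}" for r :: sym_ext_alg
definition "co123 r = ext_coeff r {3 :: 3, 1, 2}" for r :: sym_ext_alg

lemmas co_defs = co0_def co1_def co2_def co3_def co23_def co31_def co12_def co123_def

lemma F3_neq: "(1::3) \<noteq> 2" "(2::3) \<noteq> 1" "(1::3) \<noteq> 3" "(3::3) \<noteq> 1" "(2::3) \<noteq> 3" "(3::3) \<noteq> 2"
  by simp_all

lemma subsets_3: "T \<in> {{}, {1}, {2}, {3}, {3, 2}, {3, 1}, {1, 2}, {3, 1, 2 :: 3}}"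
proof -
  have "T \<in> Pow {1, 2, 3}" using UNIV_3 by auto
  then show ?thesis by (simp add: Pow_insert insert_commute)
qed

lemma ext_alg_3_eqI:
  assumes "co0 r = co0 s" "co1 r = co1 s" "co2 r = co2 s" "co3 r = co3 s"
    "co23 r = co23 s" "co31 r = co31 s" "co12 r = co12 s" "co123 r = co123 s"
  shows "r = s"
proof (rule ext_alg_eqI)
  show "ext_coeff r T = ext_coeff s T" for T
    using subsets_3[of T] assms unfolding co_defs by auto
qed

lemma co_linear [simp]:
  "co0 (r + s) = co0 r + co0 s" "co1 (r + s) = co1 r + co1 s" "co2 (r + s) = co2 r + co2 s"
  "co3 (r + s) = co3 r + co3 s" "co23 (r + s) = co23 r + co23 s" "co31 (r + s) = co31 r + co31 s"
  "co12 (r + s) = co12 r + co12 s" "co123 (r + s) = co123 r + co123 s"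
  by (simp_all add: co_defs)

lemma co_const [simp]:
  "co0 (ext_const p) = p" "co1 (ext_const p) = 0" "co2 (ext_const p) = 0" "co3 (ext_const p) = 0"
  "co23 (ext_const p) = 0" "co31 (ext_const p) = 0" "co12 (ext_const p) = 0" "co123 (ext_const p) = 0"
  by (simp_all add: co_defs)

lemma co_Y [simp]:
  "co0 (Y i) = 0" "co1 (Y i) = (if i = 1 then 1 else 0)" "co2 (Y i) = (if i = 2 then 1 else 0)"
  "co3 (Y i) = (if i = 3 then 1 else 0)"
  "co23 (Y i) = 0" "co31 (Y i) = 0" "co12 (Y i) = 0" "co123 (Y i) = 0"
  using F3_neq unfolding co_defs Y_def ext_gen_def by auto

section \<open>Multiplication in terms of the eight components\<close>

lemma Pow_3:
  "Pow {a, b :: 3} = {{}, {a}, {b}, {a, b}}"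
  "Pow {a, b, c :: 3} = {{}, {a}, {b}, {c}, {a, b}, {a, c}, {b, c}, {a, b, c}}"
  by (auto simp: Pow_insert)

lemma ext_sign_3:
  "(ext_sign {1::3} {2} :: sym_alg) = 1" "(ext_sign {2::3} {1} :: sym_alg) = -1"
  "(ext_sign {3::3} {2} :: sym_alg) = 1" "(ext_sign {2::3} {3} :: sym_alg) = -1"
  "(ext_sign {3::3} {1} :: sym_alg) = 1" "(ext_sign {1::3} {3} :: sym_alg) = -1"
  unfolding ext_sign_singletons by (simp_all only: F3_less if_True if_False)

lemma ext_sign_3':
  assumes "a \<noteq> b"
  shows "(ext_sign {a, b :: 3} {c} :: sym_alg) = ext_sign {a} {c} * ext_sign {b} {c}"
    "(ext_sign {c} {a, b :: 3} :: sym_alg) = ext_sign {c} {a} * ext_sign {c} {b}"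
  using ext_sign_Un_left[of "{a}" "{b}" "{c}"] ext_sign_Un_right[of "{a}" "{b}" "{c}"] assms
  by (simp_all add: insert_commute)

lemma set_neq_3:
  assumes "a \<noteq> b" "b \<noteq> c" "a \<noteq> c"
  shows "{a} \<noteq> {b}" "{a} \<noteq> {c}" "{b} \<noteq> {c}" "{a, b} \<noteq> {a, c}" "{a, b} \<noteq> {b, c}" "{a, c} \<noteq> {b, c}"
    "{a} \<noteq> {a, b}" "{a} \<noteq> {a, c}" "{a} \<noteq> {b, c}" "{b} \<noteq> {a, b}" "{b} \<noteq> {a, c}" "{b} \<noteq> {b, c}"
    "{c} \<noteq> {a, b}" "{c} \<noteq> {a, c}" "{c} \<noteq> {b, c}" "{a} \<noteq> {a, b, c}" "{b} \<noteq> {a, b, c}"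
    "{c} \<noteq> {a, b, c}" "{a, b} \<noteq> {a, b, c}" "{a, c} \<noteq> {a, b, c}" "{b, c} \<noteq> {a, b, c}"
  using assms by auto

lemma set_diff_3:
  fixes a b c :: 'a assumes "a \<noteq> b" "b \<noteq> c" "a \<noteq> c"
  shows "{a, b} - {a} = {b}" "{a, b} - {b} = {a}" "{a, b} - {a, b} = {}"
    "{a, b, c} - {a} = {b, c}" "{a, b, c} - {b} = {a, c}" "{a, b, c} - {c} = {a, b}"
    "{a, b, c} - {a, b} = {c}" "{a, b, c} - {a, c} = {b}" "{a, b, c} - {b, c} = {a}"
    "{a, b, c} - {a, b, c} = {}"
  using assms by auto

lemma ext_coeff_mult_2:
  fixes r s :: sym_ext_alg
  assumes "a \<noteq> b"
  shows "ext_coeff (r * s) {a, b} = ext_coeff r {} * ext_coeff s {a, b} +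
    ext_sign {a} {b} * ext_coeff r {a} * ext_coeff s {b} +
    ext_sign {b} {a} * ext_coeff r {b} * ext_coeff s {a} + ext_coeff r {a, b} * ext_coeff s {}"
proof -
  have "{a} \<noteq> {b}" "{a} \<noteq> {a, b}" "{b} \<noteq> {a, b}" "{} \<noteq> {a, b}" using assms by auto
  then show ?thesis
    unfolding times_ext_alg_def ext_coeff_Ext Pow_3
    using assms by (simp add: set_diff_3 insert_Diff_if)
qed

text \<open>The sign in \<open>co23\<close> makes these rules stable under cyclic shifts of the
  indices: two elements of exterior degree 1 multiply by the cross product of their coefficient
  vectors.\<close>

lemma co_mult [simp]:
  "co0 (r * s) = co0 r * co0 s"
  "co1 (r * s) = co0 r * co1 s + co1 r * co0 s"
  "co2 (r * s) = co0 r * co2 s + co2 r * co0 s"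
  "co3 (r * s) = co0 r * co3 s + co3 r * co0 s"
  "co23 (r * s) = co0 r * co23 s + co23 r * co0 s + co2 r * co3 s - co3 r * co2 s"
  "co31 (r * s) = co0 r * co31 s + co31 r * co0 s + co3 r * co1 s - co1 r * co3 s"
  "co12 (r * s) = co0 r * co12 s + co12 r * co0 s + co1 r * co2 s - co2 r * co1 s"
  unfolding co_defs ext_coeff_mult_2[OF F3_neq(1)] ext_coeff_mult_2[OF F3_neq(4)]
    ext_coeff_mult_2[OF F3_neq(6)] ext_sign_3
  by (simp_all add: times_ext_alg_def Pow_insert algebra_simps)

text \<open>In increasing order \<open>{3, 1, 2}\<close> stands for \<open>Y 3 * Y 1 * Y 2\<close>,
  an even permutation of \<open>Y 1 * Y 2 * Y 3\<close>. Hence \<open>co123\<close> carries no sign,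
  and all eight terms are positive.\<close>

lemma co_mult_123 [simp]:
  "co123 (r * s) = co0 r * co123 s + co123 r * co0 s + co1 r * co23 s + co2 r * co31 s + co3 r * co12 s
    + co23 r * co1 s + co31 r * co2 s + co12 r * co3 s"
proof -
  note d = set_diff_3[of "3::3" 1 2, OF F3_neq(4,1,6)]
  have P: "Pow {3::3, 1, 2} = {{}, {3}, {1}, {2}, {3, 1}, {3, 2}, {1, 2}, {3, 1, 2}}"
    by (rule Pow_3)
  note ne = set_neq_3[of "3::3" 1 2, OF F3_neq(4,1,6)]
  have "co123 (r * s) = ext_coeff r {} * ext_coeff s {3, 1, 2} + (ext_coeff r {3} * ext_coeff s {1, 2}
     + (- ext_coeff r {1} * ext_coeff s {3, 2} + (ext_coeff r {2} * ext_coeff s {3, 1}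
     + (ext_coeff r {3, 1} * ext_coeff s {2} + (- ext_coeff r {3, 2} * ext_coeff s {1}
     + (ext_coeff r {1, 2} * ext_coeff s {3} + ext_coeff r {3, 1, 2} * ext_coeff s {}))))))"
    unfolding co123_def times_ext_alg_def ext_coeff_Ext P
    by (simp add: ne d ext_sign_3 ext_sign_3' F3_neq ne[symmetric])
  then show ?thesis by (simp add: co_defs)
qed

text \<open>In exterior degrees 1 and 2, invariance under \<open>gU\<close> forces the second and
  third coefficients to be the shifts of the first by \<open>\<rho>\<close>; in degree 3 there is
  only one coefficient.\<close>

definition "C f = ext_const f * Y 1 + ext_const (\<rho> f) * Y 2 + ext_const (\<rho> (\<rho> f)) * Y 3"
definition "D f = ext_const f * (Y 2 * Y 3) + ext_const (\<rho> f) * (Y 3 * Y 1) + ext_const (\<rho> (\<rho> f)) * (Y 1 * Y 2)"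
definition "T f = ext_const f * (Y 1 * Y 2 * Y 3)"

lemma co_C [simp]: "co0 (C f) = 0" "co1 (C f) = f" "co2 (C f) = \<rho> f" "co3 (C f) = \<rho> (\<rho> f)"
  "co23 (C f) = 0" "co31 (C f) = 0" "co12 (C f) = 0" "co123 (C f) = 0"
  by (simp_all add: C_def F3_neq)

lemma co_D [simp]: "co0 (D f) = 0" "co1 (D f) = 0" "co2 (D f) = 0" "co3 (D f) = 0"
  "co23 (D f) = f" "co31 (D f) = \<rho> f" "co12 (D f) = \<rho> (\<rho> f)" "co123 (D f) = 0"
  by (simp_all add: D_def F3_neq)

lemma co_T [simp]: "co0 (T f) = 0" "co1 (T f) = 0" "co2 (T f) = 0" "co3 (T f) = 0"
  "co23 (T f) = 0" "co31 (T f) = 0" "co12 (T f) = 0" "co123 (T f) = f"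
  by (simp_all add: T_def F3_neq)

section \<open>The action of two generators of the group\<close>

definition "gU = (vector [vector [1, 1], vector [0, 1]] :: F3^2^2)"
definition "gS = (vector [vector [0, 1], vector [-1, 0]] :: F3^2^2)"

lemma gU_gS_SL2: "gU \<in> SL2" "gS \<in> SL2"
  by (simp_all add: SL2_def det_2 gU_def gS_def)

lemma one_SL2: "mat 1 \<in> SL2"
  by (simp add: SL2_def)

section \<open>Generation of the group by two matrices\<close>

lemma mat2_eq_iff: "(g :: F3^2^2) = h \<longleftrightarrow>
    g $ 1 $ 1 = h $ 1 $ 1 \<and> g $ 1 $ 2 = h $ 1 $ 2 \<and> g $ 2 $ 1 = h $ 2 $ 1 \<and> g $ 2 $ 2 = h $ 2 $ 2"
  by (auto simp: vec_eq_iff forall_2)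

lemma mat2_mult: "((g :: F3^2^2) ** h) $ i $ j = g $ i $ 1 * h $ 1 $ j + g $ i $ 2 * h $ 2 $ j"
  by (simp add: matrix_matrix_mult_def sum_2)

lemma mat2_one: "(mat 1 :: F3^2^2) $ 1 $ 1 = 1" "(mat 1 :: F3^2^2) $ 1 $ 2 = 0"
  "(mat 1 :: F3^2^2) $ 2 $ 1 = 0" "(mat 1 :: F3^2^2) $ 2 $ 2 = 1"
  by (simp_all add: mat_def)

text \<open>This is the Bruhat decomposition: a matrix with lower left entry 0 is \<open>u t\<close>
  up to sign, any other is a product \<open>u s ** w c ** u t\<close>. Inverses of the two
  generators are positive powers of them, so closure under products suffices.\<close>

lemma SL2_generated:
  assumes one: "P (mat 1)" and U: "P gU" and S: "P gS"
    and mult: "\<And>g h. P g \<Longrightarrow> P h \<Longrightarrow> P (g ** h)" and g: "g \<in> SL2"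
  shows "P g"
proof -
  define u where "u t = (vector [vector [1, t], vector [0, 1]] :: F3^2^2)" for t
  define w where "w c = (vector [vector [0, - c], vector [c, 0]] :: F3^2^2)" for c
  note defs = mat2_eq_iff mat2_mult mat2_one u_def w_def gU_def gS_def
  have u: "P (u t)" for t
  proof -
    have "u 3 = mat 1" "u 1 = gU" "u 2 = gU ** gU" by (simp_all add: defs)
    then show ?thesis using exhaust_3[of t] one U mult[OF U U] by auto
  qed
  have w: "P (w 1)" "P (w 2)"
  proof -
    have "w 1 = gS ** gS ** gS" "w 2 = gS" by (simp_all add: defs)
    then show "P (w 1)" "P (w 2)" using S mult by simp_all
  qed
  \<comment> \<open>This product is minus the identity.\<close>
  have minus: "P (w 1 ** w 1)" using w mult by blast
  have det: "g $ 1 $ 1 * g $ 2 $ 2 - g $ 1 $ 2 * g $ 2 $ 1 = 1"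
    using g by (simp add: SL2_def det_2)
  show ?thesis
  proof (cases "g $ 2 $ 1 = 0")
    case True
    then have "g $ 1 $ 1 * g $ 2 $ 2 = 1" using det by simp
    then have "g $ 1 $ 1 = 1 \<and> g $ 2 $ 2 = 1 \<or> g $ 1 $ 1 = - 1 \<and> g $ 2 $ 2 = - 1"
      using exhaust_3[of "g $ 1 $ 1"] exhaust_3[of "g $ 2 $ 2"] by auto
    then have "g = u (g $ 1 $ 2) \<or> g = w 1 ** w 1 ** u (- g $ 1 $ 2)"
      using True by (auto simp: defs)
    then show ?thesis using u mult[OF minus] by metis
  next
    case False
    let ?c = "g $ 2 $ 1"
    \<comment> \<open>Nonzero elements of the field are their own inverses, so the quotients by
      \<open>?c\<close> in the decomposition can be written as products with
      \<open>?c\<close>.\<close>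
    have c: "?c * ?c = 1" using F3_field False by blast
    have 1: "g $ 1 $ 1 = g $ 1 $ 1 * ?c * ?c" by (simp only: mult.assoc c mult_1_right)
    have 2: "g $ 2 $ 2 = ?c * (?c * g $ 2 $ 2)" by (simp only: mult.assoc[symmetric] c mult_1_left)
    have "g $ 1 $ 1 * ?c * ?c * (?c * g $ 2 $ 2) = ?c * ?c * ?c * (g $ 1 $ 1 * g $ 2 $ 2)"
      by (simp only: mult_ac)
    also have "g $ 1 $ 1 * g $ 2 $ 2 = 1 + g $ 1 $ 2 * ?c"
      using det by (simp only: diff_eq_eq)
    also have "?c * ?c * ?c * (1 + g $ 1 $ 2 * ?c) = ?c * ?c * (?c + ?c * ?c * g $ 1 $ 2)"
      by (simp only: distrib_left mult_ac mult_1_right mult_1_left)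
    finally have 3: "g $ 1 $ 2 = g $ 1 $ 1 * ?c * ?c * (?c * g $ 2 $ 2) - ?c"
      unfolding c by simp
    then have "g = u (g $ 1 $ 1 * ?c) ** w ?c ** u (?c * g $ 2 $ 2)"
      using 1 2 3 by (simp add: defs)
    moreover have "P (w ?c)" using w False exhaust_3[of ?c] by auto
    ultimately show ?thesis using u mult by metis
  qed
qed

lemma invariants_iff: "r \<in> invariants \<longleftrightarrow> act gU r = r \<and> act gS r = r"
proof
  assume r: "act gU r = r \<and> act gS r = r"
  have "g \<in> SL2 \<and> act g r = r" if g: "g \<in> SL2" for g
  proof (rule SL2_generated[where P = "\<lambda>g. g \<in> SL2 \<and> act g r = r", OF _ _ _ _ g])
    show "mat 1 \<in> SL2 \<and> act (mat 1) r = r" using one_SL2 act_one by blast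
    show "gU \<in> SL2 \<and> act gU r = r" "gS \<in> SL2 \<and> act gS r = r" using r gU_gS_SL2 by blast+
    show "g ** h \<in> SL2 \<and> act (g ** h) r = r" if "g \<in> SL2 \<and> act g r = r" "h \<in> SL2 \<and> act h r = r" for g h
      using that SL2_mult act_mult by metis
  qed
  then show "r \<in> invariants" by (simp add: invariants_def)
qed (use gU_gS_SL2 in \<open>simp add: invariants_def\<close>)

text \<open>A linear form is the combination of the dual basis whose coefficients are its values on
  \<open>basis_M\<close>, and \<open>g\<close> moves a form by conjugating its argument with the
  inverse \<open>h\<close>.\<close>

lemma act_gen:
  assumes "g \<in> SL2" "g ** h = mat 1" "h ** g = mat 1"
  shows "act g (X i) = (\<Sum>j\<in>UNIV. scalar (dual_basis_M i (h ** basis_M j ** g)) * X j)"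
    "act g (Y i) = (\<Sum>j\<in>UNIV. scalar (dual_basis_M i (h ** basis_M j ** g)) * Y j)"
proof -
  have "matrix_inv g = h" "matrix_inv h = g" using assms matrix_inv_eqI by blast+
  then have "dual_act g (dual_basis_M i) v = dual_basis_M i (h ** v ** g)" for v
    by (simp add: dual_act_def conj_act_def)
  moreover have "act g (sym_incl (dual_basis_M i)) = sym_incl (dual_act g (dual_basis_M i))"
    "act g (ext_incl (dual_basis_M i)) = ext_incl (dual_act g (dual_basis_M i))"
    using act_extends[OF assms(1)] dual_basis_M_in_dual_M by (auto simp: extends_dual_act_def)
  ultimately show "act g (X i) = (\<Sum>j\<in>UNIV. scalar (dual_basis_M i (h ** basis_M j ** g)) * X j)"
    "act g (Y i) = (\<Sum>j\<in>UNIV. scalar (dual_basis_M i (h ** basis_M j ** g)) * Y j)"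
    by (simp_all add: sym_incl_dual_basis_M ext_incl_dual_basis_M)
      (simp_all add: sym_incl_def ext_incl_def)
qed

lemma scalar_minus_one: "scalar (- 1) = - 1"
  by (simp add: scalar_def single_uminus ext_const_hom)

lemma act_gU_gen: "act gU (X 1) = X 2" "act gU (X 2) = X 3" "act gU (X 3) = X 1"
  "act gU (Y 1) = Y 2" "act gU (Y 2) = Y 3" "act gU (Y 3) = Y 1"
proof -
  have "gU ** vector [vector [1, -1], vector [0, 1]] = mat 1"
    "vector [vector [1, -1], vector [0, 1]] ** gU = mat 1"
    by (simp_all add: mat2_eq_iff mat2_mult mat2_one gU_def)
  note 1 = act_gen[OF gU_gS_SL2(1) this]
  let ?c = "\<lambda>i j. dual_basis_M i (vector [vector [1, -1], vector [0, 1]] ** basis_M j ** gU)"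
  have 2: "?c 1 1 = 0" "?c 1 2 = 1" "?c 1 3 = 0" "?c 2 1 = 0" "?c 2 2 = 0" "?c 2 3 = 1" "?c 3 1 = 1" "?c 3 2 = 0" "?c 3 3 = 0"
    by (simp_all add: dual_basis_M_def basis_M_def mat2_mult gU_def)
  show "act gU (X 1) = X 2" "act gU (X 2) = X 3" "act gU (X 3) = X 1"
  "act gU (Y 1) = Y 2" "act gU (Y 2) = Y 3" "act gU (Y 3) = Y 1"
    unfolding 1 sum_3 2 by (simp_all add: scalar_hom scalar_minus_one)
qed

lemma act_gS_gen: "act gS (X 1) = X 1" "act gS (X 2) = - X 2" "act gS (X 3) = - X 3"
  "act gS (Y 1) = Y 1" "act gS (Y 2) = - Y 2" "act gS (Y 3) = - Y 3"
proof -
  have "gS ** vector [vector [0, -1], vector [1, 0]] = mat 1"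
    "vector [vector [0, -1], vector [1, 0]] ** gS = mat 1"
    by (simp_all add: mat2_eq_iff mat2_mult mat2_one gS_def)
  note 1 = act_gen[OF gU_gS_SL2(2) this]
  let ?c = "\<lambda>i j. dual_basis_M i (vector [vector [0, -1], vector [1, 0]] ** basis_M j ** gS)"
  have 2: "?c 1 1 = 1" "?c 1 2 = 0" "?c 1 3 = 0" "?c 2 1 = 0" "?c 2 2 = - 1" "?c 2 3 = 0" "?c 3 1 = 0" "?c 3 2 = 0" "?c 3 3 = - 1"
    by (simp_all add: dual_basis_M_def basis_M_def mat2_mult gS_def)
  show "act gS (X 1) = X 1" "act gS (X 2) = - X 2" "act gS (X 3) = - X 3"
  "act gS (Y 1) = Y 1" "act gS (Y 2) = - Y 2" "act gS (Y 3) = - Y 3"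
    unfolding 1 sum_3 2 by (simp_all add: scalar_hom scalar_minus_one)
qed

lemma alg_hom_act: "g \<in> SL2 \<Longrightarrow> alg_hom (act g)"
  using act_extends by (auto simp: extends_dual_act_def)

text \<open>Both sides respect sums and products in \<open>p\<close>, and they agree on constants
  and variables.\<close>

lemma alg_hom_const:
  assumes "alg_hom \<phi>" "\<And>i. \<phi> (X i) = ext_const (\<sigma> i)"
  shows "\<phi> (ext_const p) = ext_const (poly_subst \<sigma> p)"
proof -
  have "p \<in> {p. \<phi> (ext_const p) = ext_const (poly_subst \<sigma> p)}"
  proof (rule poly_gens_generate, goal_cases)
    case (1 c)
    then show ?case using assms(1) by (simp add: alg_hom_def scalar_def[symmetric])
  next
    case (2 i)
    then show ?case using assms(2)[of i] poly_subst_gen[of \<sigma> i] by (simp add: X_def)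
  qed (use assms(1) in \<open>auto simp: alg_hom_def ext_const_hom poly_subst_add poly_subst_mult\<close>)
  then show ?thesis by simp
qed

lemma act_const: "act gU (ext_const p) = ext_const (\<rho> p)" "act gS (ext_const p) = ext_const (\<tau> p)"
proof -
  show "act gU (ext_const p) = ext_const (\<rho> p)"
    unfolding \<rho>_def
    by (rule alg_hom_const[OF alg_hom_act[OF gU_gS_SL2(1)]])
      (use exhaust_3 act_gU_gen in \<open>auto simp: X_eq[symmetric]\<close>)
  show "act gS (ext_const p) = ext_const (\<tau> p)"
    unfolding \<tau>_def
    by (rule alg_hom_const[OF alg_hom_act[OF gU_gS_SL2(2)]])
      (use exhaust_3 act_gS_gen in \<open>auto simp: ext_const_hom X_eq[symmetric]\<close>)
qed

text \<open>Writing \<open>r\<close> through constants and the \<open>Y i\<close> lets a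
  homomorphism be evaluated component by component.\<close>

lemma co_expansion: "r = ext_const (co0 r) + ext_const (co1 r) * Y 1 + ext_const (co2 r) * Y 2
  + ext_const (co3 r) * Y 3 + ext_const (co23 r) * (Y 2 * Y 3) + ext_const (co31 r) * (Y 3 * Y 1)
  + ext_const (co12 r) * (Y 1 * Y 2) + ext_const (co123 r) * (Y 1 * Y 2 * Y 3)"
  by (rule ext_alg_3_eqI) simp_all

lemma co_minus [simp]:
  "co0 (- r) = - co0 r" "co1 (- r) = - co1 r" "co2 (- r) = - co2 r" "co3 (- r) = - co3 r"
  "co23 (- r) = - co23 r" "co31 (- r) = - co31 r" "co12 (- r) = - co12 r" "co123 (- r) = - co123 r"
  "co0 (r - s) = co0 r - co0 s" "co1 (r - s) = co1 r - co1 s" "co2 (r - s) = co2 r - co2 s"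
  "co3 (r - s) = co3 r - co3 s" "co23 (r - s) = co23 r - co23 s" "co31 (r - s) = co31 r - co31 s"
  "co12 (r - s) = co12 r - co12 s" "co123 (r - s) = co123 r - co123 s"
  by (simp_all add: co_defs)

lemma co_act_gU:
  "co0 (act gU r) = \<rho> (co0 r)" "co1 (act gU r) = \<rho> (co3 r)" "co2 (act gU r) = \<rho> (co1 r)"
  "co3 (act gU r) = \<rho> (co2 r)" "co23 (act gU r) = \<rho> (co12 r)" "co31 (act gU r) = \<rho> (co23 r)"
  "co12 (act gU r) = \<rho> (co31 r)" "co123 (act gU r) = \<rho> (co123 r)"
proof -
  have "act gU (r + s) = act gU r + act gU s" "act gU (r * s) = act gU r * act gU s" for r s
    using alg_hom_act[OF gU_gS_SL2(1)] by (auto simp: alg_hom_def)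
  then show "co0 (act gU r) = \<rho> (co0 r)" "co1 (act gU r) = \<rho> (co3 r)" "co2 (act gU r) = \<rho> (co1 r)"
  "co3 (act gU r) = \<rho> (co2 r)" "co23 (act gU r) = \<rho> (co12 r)" "co31 (act gU r) = \<rho> (co23 r)"
  "co12 (act gU r) = \<rho> (co31 r)" "co123 (act gU r) = \<rho> (co123 r)"
    by (subst co_expansion[of r]; simp add: act_const act_gU_gen)+
qed

lemma co_act_gS:
  "co0 (act gS r) = \<tau> (co0 r)" "co1 (act gS r) = \<tau> (co1 r)" "co2 (act gS r) = - \<tau> (co2 r)"
  "co3 (act gS r) = - \<tau> (co3 r)" "co23 (act gS r) = \<tau> (co23 r)" "co31 (act gS r) = - \<tau> (co31 r)"
  "co12 (act gS r) = - \<tau> (co12 r)" "co123 (act gS r) = \<tau> (co123 r)"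
proof -
  have "act gS (r + s) = act gS r + act gS s" "act gS (r * s) = act gS r * act gS s" for r s
    using alg_hom_act[OF gU_gS_SL2(2)] by (auto simp: alg_hom_def)
  then show "co0 (act gS r) = \<tau> (co0 r)" "co1 (act gS r) = \<tau> (co1 r)" "co2 (act gS r) = - \<tau> (co2 r)"
  "co3 (act gS r) = - \<tau> (co3 r)" "co23 (act gS r) = \<tau> (co23 r)" "co31 (act gS r) = - \<tau> (co31 r)"
  "co12 (act gS r) = - \<tau> (co12 r)" "co123 (act gS r) = \<tau> (co123 r)"
    by (subst co_expansion[of r]; simp add: act_const act_gS_gen)+
qed

section \<open>Invariants and covariants of the polynomial ring\<close>

lemma tau_hom [simp]: "\<tau> (p + q) = \<tau> p + \<tau> q" "\<tau> (p * q) = \<tau> p * \<tau> q" "\<tau> 0 = 0"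
  "\<tau> x\<^sub>1 = x\<^sub>1" "\<tau> x\<^sub>2 = - x\<^sub>2" "\<tau> x\<^sub>3 = - x\<^sub>3"
  by (simp_all add: \<tau>_def poly_subst_add poly_subst_mult poly_subst_x)

lemma rho_one [simp]: "\<rho> 1 = 1" and tau_one [simp]: "\<tau> 1 = 1"
  using poly_subst_const[of _ 1] by (simp_all add: \<rho>_def \<tau>_def)

lemma rho_minus [simp]: "\<rho> (- p) = - \<rho> p" "\<rho> (p - q) = \<rho> p - \<rho> q"
  by (rule cf_eqI; simp)+

lemma rho_power [simp]: "\<rho> (p ^ n) = \<rho> p ^ n" and tau_power [simp]: "\<tau> (p ^ n) = \<tau> p ^ n"
  by (induction n) simp_all

lemma rho_cubed [simp]: "\<rho> (\<rho> (\<rho> p)) = p"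
  by (rule cf_eqI) simp

section \<open>Invariant polynomials and covariants\<close>

definition sym_inv :: "sym_alg set" where
  "sym_inv = {p. \<rho> p = p \<and> \<tau> p = p}"

text \<open>The three sign changes are the conjugates of \<open>\<tau>\<close> under powers of
  \<open>\<rho>\<close>; the conditions say that they act on \<open>f\<close> as they do on
  \<open>x\<^sub>1\<close>.\<close>

definition cov :: "sym_alg set" where
  "cov = {f. \<tau> f = f \<and> \<tau> (\<rho> f) = - \<rho> f \<and> \<tau> (\<rho> (\<rho> f)) = - \<rho> (\<rho> f)}"

text \<open>Invariance under \<open>gU\<close> expresses four components through \<open>co1\<close>
  and \<open>co23\<close>. After this substitution, invariance under \<open>gS\<close> becomes
  membership in \<open>cov\<close>.\<close>

lemma invariants_cases:
  assumes "r \<in> invariants"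
  shows "r = ext_const (co0 r) + C (co1 r) + D (co23 r) + T (co123 r)"
    "co0 r \<in> sym_inv" "co1 r \<in> cov" "co23 r \<in> cov" "co123 r \<in> sym_inv"
    "co2 r = \<rho> (co1 r)" "co3 r = \<rho> (\<rho> (co1 r))"
proof -
  have U: "act gU r = r" and S: "act gS r = r" using assms invariants_iff by auto
  note 1 = co_act_gU[of r, unfolded U] and 2 = co_act_gS[of r, unfolded S]
  have 3: "co2 r = \<rho> (co1 r)" "co3 r = \<rho> (\<rho> (co1 r))" "co31 r = \<rho> (co23 r)" "co12 r = \<rho> (\<rho> (co23 r))"
    using 1 by metis+
  show "co2 r = \<rho> (co1 r)" "co3 r = \<rho> (\<rho> (co1 r))" using 3 by auto
  show "co0 r \<in> sym_inv" "co123 r \<in> sym_inv" using 1 2 by (auto simp: sym_inv_def)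
  show "co1 r \<in> cov" "co23 r \<in> cov" unfolding cov_def using 2 unfolding 3
    by (metis (mono_tags, lifting) mem_Collect_eq minus_minus)+
  show "r = ext_const (co0 r) + C (co1 r) + D (co23 r) + T (co123 r)"
    by (rule ext_alg_3_eqI) (simp_all add: 3)
qed

lemma invariants_intros:
  "p \<in> sym_inv \<Longrightarrow> ext_const p \<in> invariants" "f \<in> cov \<Longrightarrow> C f \<in> invariants"
  "f \<in> cov \<Longrightarrow> D f \<in> invariants" "p \<in> sym_inv \<Longrightarrow> T p \<in> invariants"
  unfolding invariants_iff sym_inv_def cov_def
  by (safe; rule ext_alg_3_eqI; simp add: co_act_gU co_act_gS)+

lemma odd_coeff: fixes c :: F3 assumes "c = - c" shows "c = 0"
  using assms exhaust_3[of c] by auto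

lemma cf_tau_even: "\<tau> p = p \<Longrightarrow> odd (j + k) \<Longrightarrow> cf p i j k = 0"
  using cf_tau[of p i j k] by (intro odd_coeff) simp

lemma cf_tau_odd: "\<tau> p = - p \<Longrightarrow> even (j + k) \<Longrightarrow> cf p i j k = 0"
  using cf_tau[of p i j k] by (intro odd_coeff) simp

lemma sym_inv_iff: "p \<in> sym_inv \<longleftrightarrow> (\<forall>i j k. cf p i j k = cf p j k i \<and> (odd (j + k) \<longrightarrow> cf p i j k = 0))"
proof
  assume p: "p \<in> sym_inv"
  then have "cf p i j k = cf p j k i" for i j k
    using cf_rho[of p i j k] by (simp add: sym_inv_def)
  then show "\<forall>i j k. cf p i j k = cf p j k i \<and> (odd (j + k) \<longrightarrow> cf p i j k = 0)"
    using p cf_tau_even by (auto simp: sym_inv_def)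
next
  assume *: "\<forall>i j k. cf p i j k = cf p j k i \<and> (odd (j + k) \<longrightarrow> cf p i j k = 0)"
  have "\<rho> p = p" by (intro cf_eqI) (simp, metis *)
  moreover have "\<tau> p = p"
  proof (rule cf_eqI)
    show "cf (\<tau> p) i j k = cf p i j k" for i j k
      using * by (cases "even (j + k)") (auto simp: cf_tau simp del: even_add)
  qed
  ultimately show "p \<in> sym_inv" by (simp add: sym_inv_def)
qed

lemma sym_inv_parity: "p \<in> sym_inv \<Longrightarrow> odd (i + j) \<or> odd (j + k) \<Longrightarrow> cf p i j k = 0"
  by (metis sym_inv_iff)

text \<open>The surviving exponents have parities odd, even, even or even, odd, odd: the monomial is
  \<open>x\<^sub>1\<close> or \<open>x\<^sub>2 * x\<^sub>3\<close> times a monomial in the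
  squares.\<close>

lemma cov_parity:
  assumes "f \<in> cov" "even (i + j) \<or> odd (j + k)" shows "cf f i j k = 0"
proof (cases "odd (j + k)")
  case True
  then show ?thesis using assms(1) cf_tau_even by (simp add: cov_def)
next
  case False
  then have "even (i + j)" using assms by blast
  then have "cf (\<rho> f) k i j = 0" using assms(1) cf_tau_odd[of "\<rho> f" i j k] by (simp add: cov_def)
  then show ?thesis by simp
qed

text \<open>
  The polynomial ring in \<open>u, v, w\<close> is spanned over the symmetric polynomials by Artin's basis
  \<open>1, u, u\<^sup>2, v, u v, u\<^sup>2 v\<close>.
\<close>

context
  fixes K :: "'a::comm_ring_1 set" and u v w :: 'a
  assumes add: "\<And>f g. f \<in> K \<Longrightarrow> g \<in> K \<Longrightarrow> f + g \<in> K" and minus: "\<And>f. f \<in> K \<Longrightarrow> - f \<in> K"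
    and e: "\<And>f. f \<in> K \<Longrightarrow> (u + v + w) * f \<in> K" "\<And>f. f \<in> K \<Longrightarrow> (u * v + v * w + w * u) * f \<in> K"
      "\<And>f. f \<in> K \<Longrightarrow> u * v * w * f \<in> K"
begin

text \<open>Since \<open>K\<close> is only stable under symmetric polynomials, an induction over
  powers of \<open>u\<close>, \<open>v\<close>, \<open>w\<close> has to carry all six multiples by
  Artin's basis.\<close>

definition artin_closed where
  "artin_closed = {f. f \<in> K \<and> f * u \<in> K \<and> f * (u * u) \<in> K \<and> f * v \<in> K \<and> f * (u * v) \<in> K \<and> f * (u * u * v) \<in> K}"

text \<open>Let e1, e2, e3 be the elementary symmetric polynomials. Products leaving Artin's basis
  are reduced by \<open>u^3 = e1 u^2 - e2 u + e3\<close> and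
  \<open>u^2 + u v + v^2 = e1 (u + v) - e2\<close>, or by consequences of these; \<open>w\<close> is
  \<open>e1 - u - v\<close>.\<close>

lemma artin_step:
  assumes f: "f \<in> artin_closed"
  shows "f * u \<in> artin_closed" "f * v \<in> artin_closed" "f * w \<in> artin_closed"
proof -
  have diff: "a - b \<in> K" if "a \<in> K" "b \<in> K" for a b
    using add[OF that(1) minus[OF that(2)]] by simp
  have f1: "f \<in> K" and f2: "f * u \<in> K" and f3: "f * (u * u) \<in> K" and f4: "f * v \<in> K"
    and f5: "f * (u * v) \<in> K" and f6: "f * (u * u * v) \<in> K"
    using f by (auto simp: artin_closed_def)
  have uuu: "f * u * (u * u) \<in> K"
  proof -
    have "f * u * (u * u) = (u + v + w) * (f * (u * u)) - (u * v + v * w + w * u) * (f * u) + u * v * w * f"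
      by (simp add: algebra_simps)
    then show ?thesis using f1 f2 f3 e add diff by metis
  qed
  have uuuv: "f * u * (u * u * v) \<in> K"
  proof -
    have "f * u * (u * u * v) = (u + v + w) * (f * (u * u * v)) - (u * v + v * w + w * u) * (f * (u * v)) + u * v * w * (f * v)"
      by (simp add: algebra_simps)
    then show ?thesis using f4 f5 f6 e add diff by metis
  qed
  have vv: "f * v * v \<in> K"
  proof -
    have "f * v * v = (u + v + w) * (f * v) - f * (u * v) - f * (u * u) + (u + v + w) * (f * u) - (u * v + v * w + w * u) * f"
      by (simp add: algebra_simps)
    then show ?thesis using f1 f2 f3 f4 f5 e add diff by metis
  qed
  have uvv: "f * v * (u * v) \<in> K"
  proof -
    have "f * v * (u * v) = (u + v + w) * (f * (u * v)) - f * (u * u * v) - u * v * w * f"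
      by (simp add: algebra_simps)
    then show ?thesis using f1 f5 f6 e add diff by metis
  qed
  have uuvv: "f * v * (u * u * v) \<in> K"
  proof -
    have "f * v * (u * u * v) = (u * v + v * w + w * u) * (f * (u * v)) - u * v * w * (f * v) - u * v * w * (f * u)"
      by (simp add: algebra_simps)
    then show ?thesis using f2 f4 f5 e add diff by metis
  qed
  show fu: "f * u \<in> artin_closed"
    using f2 f3 uuu f5 f6 uuuv by (simp add: artin_closed_def mult.assoc)
  have "f * v * u \<in> K" "f * v * (u * u) \<in> K" using f5 f6 by (simp_all add: ac_simps)
  then show fv: "f * v \<in> artin_closed"
    using f4 vv uvv uuvv by (simp add: artin_closed_def)
  have add_B: "a - b \<in> artin_closed" if "a \<in> artin_closed" "b \<in> artin_closed" for a b
    using that diff by (simp add: artin_closed_def left_diff_distrib)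
  have "(u + v + w) * f \<in> artin_closed"
    using f e(1) by (simp add: artin_closed_def mult.assoc)
  moreover have "f * w = (u + v + w) * f - f * u - f * v" by (simp add: algebra_simps)
  ultimately show "f * w \<in> artin_closed" using fu fv add_B by metis
qed

text \<open>The factor \<open>h\<close> is the odd part of a monomial: it will be 1,
  \<open>x\<^sub>1\<close> or \<open>x\<^sub>2 * x\<^sub>3\<close>, with the squares of the
  variables as \<open>u\<close>, \<open>v\<close>, \<open>w\<close>.\<close>

lemma artin_monomials:
  assumes "h \<in> K" "h * u \<in> K" "h * (u * u) \<in> K" "h * v \<in> K" "h * (u * v) \<in> K" "h * (u * u * v) \<in> K"
  shows "h * u ^ i * v ^ j * w ^ k \<in> K"
proof -
  have u: "h * u ^ i \<in> artin_closed"
  proof (induction i)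
    case (Suc i)
    then show ?case using artin_step(1)[OF Suc] by (simp add: ac_simps)
  qed (use assms in \<open>simp add: artin_closed_def\<close>)
  have v: "h * u ^ i * v ^ j \<in> artin_closed"
  proof (induction j)
    case (Suc j)
    then show ?case using artin_step(2)[OF Suc] by (simp add: ac_simps)
  qed (simp add: u)
  have "h * u ^ i * v ^ j * w ^ k \<in> artin_closed"
  proof (induction k)
    case (Suc k)
    then show ?case using artin_step(3)[OF Suc] by (simp add: ac_simps)
  qed (simp add: v)
  then show ?thesis by (simp add: artin_closed_def)
qed

end

text \<open>The only nonzero scalars are 1 and -1, so closure under sums and negation replaces
  linearity.\<close>

lemma poly_sum_monoms_mem:
  fixes K :: "sym_alg set"
  assumes "0 \<in> K" and add: "\<And>f g. f \<in> K \<Longrightarrow> g \<in> K \<Longrightarrow> f + g \<in> K" and minus: "\<And>f. f \<in> K \<Longrightarrow> - f \<in> K"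
    and monom: "\<And>i j k. cf f i j k \<noteq> 0 \<Longrightarrow> x\<^sub>1 ^ i * x\<^sub>2 ^ j * x\<^sub>3 ^ k \<in> K"
  shows "f \<in> K"
proof -
  have scale: "Poly_Mapping.single m c \<in> K" if m: "Poly_Mapping.single m 1 \<in> K" for m and c :: F3
  proof -
    have "c = 0 \<or> c = 1 \<or> c = - 1" using exhaust_3[of c] by auto
    then show ?thesis using m assms(1) minus[OF m] by (auto simp: single_uminus)
  qed
  have "(\<Sum>m\<in>L. Poly_Mapping.single m (Poly_Mapping.lookup f m)) \<in> K" if "L \<subseteq> Poly_Mapping.keys f" for L
    using that
  proof (induction L rule: infinite_finite_induct)
    case (insert m L)
    obtain i j k where m: "m = expo i j k" by (rule expo_cases)
    then have "cf f i j k \<noteq> 0" using insert.prems by (simp add: cf_def in_keys_iff)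
    then have "Poly_Mapping.single m 1 \<in> K" using monom by (simp add: x_powers m)
    then show ?case using insert scale add by simp
  qed (use assms(1) in auto)
  then show ?thesis by (subst poly_mapping_sum_single) simp
qed

text \<open>Artin's basis in the squares, with the factors \<open>x\<^sub>1\<close> and
  \<open>x\<^sub>2 * x\<^sub>3\<close>, gives twelve generators. Multiplication by
  \<open>x\<^sub>1 * x\<^sub>2 * x\<^sub>3\<close> links the two families and leaves the six of
  \<open>base\<close>.\<close>

lemma cov_generated:
  fixes K :: "sym_alg set"
  assumes add: "\<And>f g. f \<in> K \<Longrightarrow> g \<in> K \<Longrightarrow> f + g \<in> K" and minus: "\<And>f. f \<in> K \<Longrightarrow> - f \<in> K"
    and e\<^sub>1: "\<And>f. f \<in> K \<Longrightarrow> (x\<^sub>1\<^sup>2 + x\<^sub>2\<^sup>2 + x\<^sub>3\<^sup>2) * f \<in> K"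
    and e\<^sub>2: "\<And>f. f \<in> K \<Longrightarrow> (x\<^sub>1\<^sup>2 * x\<^sub>2\<^sup>2 + x\<^sub>2\<^sup>2 * x\<^sub>3\<^sup>2 + x\<^sub>3\<^sup>2 * x\<^sub>1\<^sup>2) * f \<in> K"
    and a\<^sub>2: "\<And>f. f \<in> K \<Longrightarrow> x\<^sub>1 * x\<^sub>2 * x\<^sub>3 * f \<in> K"
    and base: "x\<^sub>1 \<in> K" "x\<^sub>2 * x\<^sub>3 \<in> K" "x\<^sub>1 ^ 3 \<in> K" "x\<^sub>1 * x\<^sub>2\<^sup>2 \<in> K" "x\<^sub>2 ^ 3 * x\<^sub>3 \<in> K" "x\<^sub>1 ^ 3 * x\<^sub>2\<^sup>2 \<in> K"
    and f: "f \<in> cov"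
  shows "f \<in> K"
proof -
  have diff: "a - b \<in> K" if "a \<in> K" "b \<in> K" for a b
    using add[OF that(1) minus[OF that(2)]] by simp
  have e\<^sub>3: "x\<^sub>1\<^sup>2 * x\<^sub>2\<^sup>2 * x\<^sub>3\<^sup>2 * f \<in> K" if "f \<in> K" for f
    using a\<^sub>2[OF a\<^sub>2[OF that]] by (simp add: power2_eq_square ac_simps)
  note artin = artin_monomials[OF add minus e\<^sub>1 e\<^sub>2 e\<^sub>3]
  \<comment> \<open>This is the cubic equation of \<open>x\<^sub>1\<^sup>2\<close> over the
    symmetric polynomials, divided by \<open>x\<^sub>1\<close>; the identity for \<open>x52\<close>
    is the same one times \<open>x\<^sub>2\<^sup>2\<close>.\<close>
  have "x\<^sub>1 * (x\<^sub>1\<^sup>2 * x\<^sub>1\<^sup>2) = (x\<^sub>1\<^sup>2 + x\<^sub>2\<^sup>2 + x\<^sub>3\<^sup>2) * x\<^sub>1 ^ 3 - (x\<^sub>1\<^sup>2 * x\<^sub>2\<^sup>2 + x\<^sub>2\<^sup>2 * x\<^sub>3\<^sup>2 + x\<^sub>3\<^sup>2 * x\<^sub>1\<^sup>2) * x\<^sub>1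
      + x\<^sub>1 * x\<^sub>2 * x\<^sub>3 * (x\<^sub>2 * x\<^sub>3)"
    by (simp add: power2_eq_square power3_eq_cube algebra_simps)
  then have x5: "x\<^sub>1 * (x\<^sub>1\<^sup>2 * x\<^sub>1\<^sup>2) \<in> K"
    using base e\<^sub>1 e\<^sub>2 a\<^sub>2 add diff by metis
  have "x\<^sub>1 * (x\<^sub>1\<^sup>2 * x\<^sub>1\<^sup>2 * x\<^sub>2\<^sup>2) = (x\<^sub>1\<^sup>2 + x\<^sub>2\<^sup>2 + x\<^sub>3\<^sup>2) * (x\<^sub>1 ^ 3 * x\<^sub>2\<^sup>2)
      - (x\<^sub>1\<^sup>2 * x\<^sub>2\<^sup>2 + x\<^sub>2\<^sup>2 * x\<^sub>3\<^sup>2 + x\<^sub>3\<^sup>2 * x\<^sub>1\<^sup>2) * (x\<^sub>1 * x\<^sub>2\<^sup>2) + x\<^sub>1 * x\<^sub>2 * x\<^sub>3 * (x\<^sub>2 ^ 3 * x\<^sub>3)"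
    by (simp add: power2_eq_square power3_eq_cube algebra_simps)
  then have x52: "x\<^sub>1 * (x\<^sub>1\<^sup>2 * x\<^sub>1\<^sup>2 * x\<^sub>2\<^sup>2) \<in> K"
    using base e\<^sub>1 e\<^sub>2 a\<^sub>2 add diff by metis
  have odd: "x\<^sub>1 * (x\<^sub>1\<^sup>2) ^ i * (x\<^sub>2\<^sup>2) ^ j * (x\<^sub>3\<^sup>2) ^ k \<in> K" for i j k
    by (rule artin) (use base x5 x52 in \<open>simp_all add: power2_eq_square power3_eq_cube ac_simps\<close>)
  \<comment> \<open>Four of the six multiples of \<open>x\<^sub>2 * x\<^sub>3\<close> by Artin's
    basis are \<open>x\<^sub>1 * x\<^sub>2 * x\<^sub>3\<close> times an element of
    \<open>base\<close>.\<close>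
  have even: "x\<^sub>2 * x\<^sub>3 * (x\<^sub>1\<^sup>2) ^ i * (x\<^sub>2\<^sup>2) ^ j * (x\<^sub>3\<^sup>2) ^ k \<in> K" for i j k
    by (rule artin)
      (use base a\<^sub>2[OF base(1)] a\<^sub>2[OF base(3)] a\<^sub>2[OF base(4)] a\<^sub>2[OF base(6)] in
        \<open>simp_all add: power2_eq_square power3_eq_cube ac_simps\<close>)
  show ?thesis
  proof (rule poly_sum_monoms_mem[OF _ add minus])
    show "0 \<in> K" using diff[OF base(1) base(1)] by simp
    fix i j k assume "cf f i j k \<noteq> 0"
    then have par: "odd (i + j)" "even (j + k)" using cov_parity[OF f] by blast+
    show "x\<^sub>1 ^ i * x\<^sub>2 ^ j * x\<^sub>3 ^ k \<in> K"
    proof (cases "even j")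
      case True
      then have "odd i" "even j" "even k" using par by auto
      then obtain a b c where "i = 2 * a + 1" "j = 2 * b" "k = 2 * c" by (meson evenE oddE)
      then show ?thesis using odd[of a b c] by (simp add: ac_simps flip: power_mult)
    next
      case False
      then have "even i" "odd j" "odd k" using par by auto
      then obtain a b c where "i = 2 * a" "j = 2 * b + 1" "k = 2 * c + 1" by (meson evenE oddE)
      then show ?thesis using even[of a b c] by (simp add: ac_simps flip: power_mult)
    qed
  qed assumption+
qed

section \<open>Orbit sums and generators of the invariant polynomials\<close>

definition "Tr f = f + \<rho> f + \<rho> (\<rho> f)"

lemma tau_diff [simp]: "\<tau> (p - q) = \<tau> p - \<tau> q"
  by (rule cf_eqI) (simp add: cf_tau right_diff_distrib)

lemma sym_inv_closed: "p \<in> sym_inv \<Longrightarrow> q \<in> sym_inv \<Longrightarrow> p - q \<in> sym_inv" "p \<in> sym_inv \<Longrightarrow> q \<in> sym_inv \<Longrightarrow> p * q \<in> sym_inv"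
  "Poly_Mapping.single 0 c \<in> sym_inv"
  by (simp_all add: sym_inv_def) (simp add: \<tau>_def)

text \<open>\<open>Tr\<close> is linear over polynomials fixed by \<open>\<rho>\<close>, so the
  preimage of \<open>A\<close> is a module to which Artin's basis applies. On that basis
  \<open>Tr\<close> takes the value 0 at 1, by characteristic 3, and values listed in
  \<open>gens\<close> elsewhere.\<close>

lemma Tr_monomial_mem:
  fixes A :: "sym_alg set"
  assumes add: "\<And>f g. f \<in> A \<Longrightarrow> g \<in> A \<Longrightarrow> f + g \<in> A" and mult: "\<And>f g. f \<in> A \<Longrightarrow> g \<in> A \<Longrightarrow> f * g \<in> A"
    and const: "\<And>c. Poly_Mapping.single 0 c \<in> A"
    and gens: "x\<^sub>1\<^sup>2 + x\<^sub>2\<^sup>2 + x\<^sub>3\<^sup>2 \<in> A" "x\<^sub>1 * x\<^sub>2 * x\<^sub>3 \<in> A" "x\<^sub>1 ^ 4 + x\<^sub>2 ^ 4 + x\<^sub>3 ^ 4 \<in> A"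
      "x\<^sub>1\<^sup>2 * x\<^sub>2\<^sup>2 + x\<^sub>2\<^sup>2 * x\<^sub>3\<^sup>2 + x\<^sub>3\<^sup>2 * x\<^sub>1\<^sup>2 \<in> A"
      "x\<^sub>1 ^ 4 * x\<^sub>2\<^sup>2 + x\<^sub>1\<^sup>2 * x\<^sub>3 ^ 4 + x\<^sub>2 ^ 4 * x\<^sub>3\<^sup>2 \<in> A"
    and par: "even (i + j)" "even (j + k)"
  shows "Tr (x\<^sub>1 ^ i * x\<^sub>2 ^ j * x\<^sub>3 ^ k) \<in> A"
proof -
  define K where "K = {f. Tr f \<in> A}"
  have minus: "- f \<in> A" if "f \<in> A" for f
    using mult[OF const[of "-1"] that] by (simp add: single_uminus)
  have K_add: "f + g \<in> K" if "f \<in> K" "g \<in> K" for f g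
    using add[of "Tr f" "Tr g"] that by (simp add: K_def Tr_def ac_simps)
  have K_minus: "- f \<in> K" if "f \<in> K" for f
    using minus that by (fastforce simp: K_def Tr_def)
  have K_mult: "p * f \<in> K" if "p \<in> A" "\<rho> p = p" "f \<in> K" for p f
    using mult[of p "Tr f"] that by (simp add: K_def Tr_def distrib_left)
  have a\<^sub>2: "x\<^sub>1 * x\<^sub>2 * x\<^sub>3 * f \<in> K" if "f \<in> K" for f
    using gens that by (intro K_mult) (simp_all add: ac_simps)
  have e: "(x\<^sub>1\<^sup>2 + x\<^sub>2\<^sup>2 + x\<^sub>3\<^sup>2) * f \<in> K" "(x\<^sub>1\<^sup>2 * x\<^sub>2\<^sup>2 + x\<^sub>2\<^sup>2 * x\<^sub>3\<^sup>2 + x\<^sub>3\<^sup>2 * x\<^sub>1\<^sup>2) * f \<in> K"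
    "x\<^sub>1\<^sup>2 * x\<^sub>2\<^sup>2 * x\<^sub>3\<^sup>2 * f \<in> K" if "f \<in> K" for f
  proof -
    show "x\<^sub>1\<^sup>2 * x\<^sub>2\<^sup>2 * x\<^sub>3\<^sup>2 * f \<in> K"
      using a\<^sub>2[OF a\<^sub>2[OF that]] by (simp add: power2_eq_square ac_simps)
  qed (use gens that in \<open>intro K_mult; simp add: ac_simps\<close>)+
  have base: "1 * (x\<^sub>1\<^sup>2) ^ a * (x\<^sub>2\<^sup>2) ^ b * (x\<^sub>3\<^sup>2) ^ c \<in> K" for a b c
  proof (rule artin_monomials[OF K_add K_minus e])
    show "1 \<in> K" using const[of 0] char_3[of 1] by (simp add: K_def Tr_def)
  qed (use gens in \<open>simp_all add: K_def Tr_def ac_simps flip: power_add\<close>)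
  show ?thesis
  proof (cases "even j")
    case True
    then have "even i" "even j" "even k" using par by auto
    then obtain a b c where "i = 2 * a" "j = 2 * b" "k = 2 * c" by (meson evenE)
    then show ?thesis using base[of a b c] by (simp add: power_mult K_def)
  next
    case False
    then have "odd i" "odd j" "odd k" using par by auto
    then obtain a b c where "i = 2 * a + 1" "j = 2 * b + 1" "k = 2 * c + 1" by (meson oddE)
    then have "x\<^sub>1 ^ i * x\<^sub>2 ^ j * x\<^sub>3 ^ k = x\<^sub>1 * x\<^sub>2 * x\<^sub>3 * (1 * (x\<^sub>1\<^sup>2) ^ a * (x\<^sub>2\<^sup>2) ^ b * (x\<^sub>3\<^sup>2) ^ c)"
      by (simp add: ac_simps flip: power_mult)
    then show ?thesis using a\<^sub>2[OF base[of a b c]] by (simp add: K_def)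
  qed
qed

text \<open>Induction on the number of monomials: a monomial of \<open>p\<close> brings its whole
  cyclic orbit with the same coefficient, and this orbit is subtracted. On a one-point orbit
  \<open>Tr\<close> vanishes in characteristic 3, so a power of
  \<open>x\<^sub>1 * x\<^sub>2 * x\<^sub>3\<close> takes its place.\<close>

lemma sym_inv_generated:
  fixes A :: "sym_alg set"
  assumes add: "\<And>f g. f \<in> A \<Longrightarrow> g \<in> A \<Longrightarrow> f + g \<in> A" and mult: "\<And>f g. f \<in> A \<Longrightarrow> g \<in> A \<Longrightarrow> f * g \<in> A"
    and const: "\<And>c. Poly_Mapping.single 0 c \<in> A"
    and gens: "x\<^sub>1\<^sup>2 + x\<^sub>2\<^sup>2 + x\<^sub>3\<^sup>2 \<in> A" "x\<^sub>1 * x\<^sub>2 * x\<^sub>3 \<in> A" "x\<^sub>1 ^ 4 + x\<^sub>2 ^ 4 + x\<^sub>3 ^ 4 \<in> A"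
      "x\<^sub>1\<^sup>2 * x\<^sub>2\<^sup>2 + x\<^sub>2\<^sup>2 * x\<^sub>3\<^sup>2 + x\<^sub>3\<^sup>2 * x\<^sub>1\<^sup>2 \<in> A"
      "x\<^sub>1 ^ 4 * x\<^sub>2\<^sup>2 + x\<^sub>1\<^sup>2 * x\<^sub>3 ^ 4 + x\<^sub>2 ^ 4 * x\<^sub>3\<^sup>2 \<in> A"
    and "p \<in> sym_inv"
  shows "p \<in> A"
  using \<open>p \<in> sym_inv\<close>
proof (induction "card (Poly_Mapping.keys p)" arbitrary: p rule: less_induct)
  case less
  show ?case
  proof (cases "p = 0")
    case True
    then show ?thesis using const[of 0] by simp
  next
    case False
    then obtain m where m: "m \<in> Poly_Mapping.keys p" by fastforce
    obtain i j k where ijk: "m = expo i j k" by (rule expo_cases)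
    define c where "c = cf p i j k"
    have c: "c \<noteq> 0" using m by (simp add: c_def cf_def ijk in_keys_iff)
    have par: "even (i + j)" "even (j + k)" using c sym_inv_parity[OF less.prems] c_def by blast+
    have cyc: "cf p a b d = cf p b d a" for a b d
      using less.prems sym_inv_iff by blast
    \<comment> \<open>\<open>q\<close> is the sum of the orbit of the chosen monomial; on its
      support \<open>p\<close> equals \<open>c\<close> times \<open>q\<close>.\<close>
    obtain q where q: "q \<in> sym_inv" "q \<in> A" "cf q i j k = 1"
      and q': "\<And>a b d. cf q a b d \<noteq> 0 \<Longrightarrow> cf p a b d = c * cf q a b d"
    proof (cases "i = j \<and> j = k")
      case True
      have *: "x\<^sub>1 ^ i * x\<^sub>2 ^ i * x\<^sub>3 ^ i = (x\<^sub>1 * x\<^sub>2 * x\<^sub>3) ^ i"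
        by (simp add: power_mult_distrib)
      have pow: "(x\<^sub>1 * x\<^sub>2 * x\<^sub>3) ^ n \<in> A" for n
        using mult[OF gens(2)] const[of 1] by (induction n) simp_all
      have cfq: "cf (x\<^sub>1 ^ i * x\<^sub>2 ^ i * x\<^sub>3 ^ i) a b d = (if a = i \<and> b = i \<and> d = i then 1 else 0)" for a b d
        by (auto simp: x_powers cf_single)
      show ?thesis
      proof (rule that)
        show "x\<^sub>1 ^ i * x\<^sub>2 ^ i * x\<^sub>3 ^ i \<in> sym_inv" unfolding * by (simp add: sym_inv_def ac_simps)
        show "x\<^sub>1 ^ i * x\<^sub>2 ^ i * x\<^sub>3 ^ i \<in> A" unfolding * by (rule pow)
        show "cf (x\<^sub>1 ^ i * x\<^sub>2 ^ i * x\<^sub>3 ^ i) i j k = 1" unfolding cfq using True by simp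
        show "cf p a b d = c * cf (x\<^sub>1 ^ i * x\<^sub>2 ^ i * x\<^sub>3 ^ i) a b d"
          if "cf (x\<^sub>1 ^ i * x\<^sub>2 ^ i * x\<^sub>3 ^ i) a b d \<noteq> 0" for a b d
          using that True unfolding cfq c_def by (simp split: if_splits)
      qed
    next
      case False
      let ?q = "Tr (x\<^sub>1 ^ i * x\<^sub>2 ^ j * x\<^sub>3 ^ k)"
      \<comment> \<open>Exponents that are not all equal have three distinct cyclic shifts, so at
        most one summand of \<open>Tr\<close> contributes to each coefficient.\<close>
      have exclusive: "(if P then 1 else 0) + (if Q then 1 else 0) + (if R then 1 else 0) = (if P \<or> Q \<or> R then 1 else (0 :: F3))"
        if "\<not> (P \<and> Q)" "\<not> (P \<and> R)" "\<not> (Q \<and> R)" for P Q R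
        using that by auto
      have cfq: "cf ?q a b d = (if i = a \<and> j = b \<and> k = d \<or> i = b \<and> j = d \<and> k = a \<or> i = d \<and> j = a \<and> k = b then 1 else 0)"
        for a b d
        unfolding Tr_def x_powers cf_simps cf_rho cf_single
        by (rule exclusive) (use False in metis)+
      have "?q \<in> sym_inv"
        unfolding sym_inv_iff cfq
      proof (intro allI conjI impI)
        fix a b d
        show "(if i = a \<and> j = b \<and> k = d \<or> i = b \<and> j = d \<and> k = a \<or> i = d \<and> j = a \<and> k = b then 1 else 0) =
            (if i = b \<and> j = d \<and> k = a \<or> i = d \<and> j = a \<and> k = b \<or> i = a \<and> j = b \<and> k = d then 1 else (0 :: F3))"
          by (simp only: disj_ac)
        assume "odd (b + d)"
        then have "\<not> (i = a \<and> j = b \<and> k = d \<or> i = b \<and> j = d \<and> k = a \<or> i = d \<and> j = a \<and> k = b)"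
          using par by (metis even_add)
        then show "(if i = a \<and> j = b \<and> k = d \<or> i = b \<and> j = d \<and> k = a \<or> i = d \<and> j = a \<and> k = b then 1 else 0) = (0 :: F3)"
          by (simp only: if_False)
      qed
      moreover have "?q \<in> A"
        by (rule Tr_monomial_mem) (fact add mult const gens par)+
      moreover have "cf p a b d = c * cf ?q a b d" if "cf ?q a b d \<noteq> 0" for a b d
      proof -
        have 1: "i = a \<and> j = b \<and> k = d \<or> i = b \<and> j = d \<and> k = a \<or> i = d \<and> j = a \<and> k = b"
          using that unfolding cfq by presburger
        then have "cf p a b d = c"
          using cyc[of i j k] cyc[of j k i] unfolding c_def by (elim disjE) simp_all
        then show ?thesis unfolding cfq using 1 by (simp only: if_True mult_1_right)
      qed
      moreover have "cf ?q i j k = 1" unfolding cfq by simp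
      ultimately show ?thesis using that[of ?q] by blast
    qed
    let ?r = "p - Poly_Mapping.single 0 c * q"
    have cfr: "cf ?r a b d = cf p a b d - c * cf q a b d" for a b d
      using cf_monom_mult[of 0 0 0 c q a b d] by (simp add: expo_zero)
    \<comment> \<open>Off the support of \<open>q\<close> nothing changes; on it the coefficients
      cancel, in particular at \<open>m\<close>.\<close>
    have "Poly_Mapping.keys ?r \<subseteq> Poly_Mapping.keys p - {m}"
    proof
      fix n assume n: "n \<in> Poly_Mapping.keys ?r"
      obtain a b d where abd: "n = expo a b d" by (rule expo_cases)
      have "cf ?r a b d \<noteq> 0" using n by (simp add: cf_def abd in_keys_iff)
      then have "cf p a b d \<noteq> c * cf q a b d" unfolding cfr by simp
      then have "cf q a b d = 0" "cf p a b d \<noteq> 0" using q'[of a b d] by fastforce+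
      then show "n \<in> Poly_Mapping.keys p - {m}"
        using q(3) by (auto simp: cf_def abd ijk in_keys_iff)
    qed
    then have "card (Poly_Mapping.keys ?r) < card (Poly_Mapping.keys p)"
      using m by (metis card_Diff1_less card_mono finite_Diff finite_keys le_less_trans)
    then have "?r \<in> A"
      by (rule less.hyps) (intro sym_inv_closed less.prems q)
    then show ?thesis
      using add[OF _ mult[OF const[of c] q(2)], of ?r] by simp
  qed
qed

section \<open>Generation\<close>

text \<open>\<open>C_mult_C\<close> produces elements of exterior degree 2: the argument of
  \<open>D\<close> is the first coordinate of the cross product of the two vectors of cyclic
  shifts.\<close>

lemma ext_const_mult_C: "\<rho> p = p \<Longrightarrow> ext_const p * C f = C (p * f)"
  and ext_const_mult_D: "\<rho> p = p \<Longrightarrow> ext_const p * D f = D (p * f)"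
  and ext_const_mult_T: "ext_const p * T q = T (p * q)"
  and C_mult_C: "C f * C g = D (\<rho> f * \<rho> (\<rho> g) - \<rho> (\<rho> f) * \<rho> g)"
  and C_add: "C (f + g) = C f + C g" and D_add: "D (f + g) = D f + D g"
  and C_minus: "C (- f) = - C f" and D_minus: "D (- f) = - D f"
  by (rule ext_alg_3_eqI; simp add: algebra_simps)+

lemma invariants_generated:
  assumes H: "subalgebra H"
    and a: "ext_const (x\<^sub>1\<^sup>2 + x\<^sub>2\<^sup>2 + x\<^sub>3\<^sup>2) \<in> H" "ext_const (x\<^sub>1 * x\<^sub>2 * x\<^sub>3) \<in> H" "ext_const (x\<^sub>1 ^ 4 + x\<^sub>2 ^ 4 + x\<^sub>3 ^ 4) \<in> H"
      "ext_const (x\<^sub>1 ^ 4 * x\<^sub>2\<^sup>2 + x\<^sub>1\<^sup>2 * x\<^sub>3 ^ 4 + x\<^sub>2 ^ 4 * x\<^sub>3\<^sup>2) \<in> H"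
    and c: "C x\<^sub>1 \<in> H" "C (x\<^sub>2 * x\<^sub>3) \<in> H" "C (x\<^sub>1 ^ 3) \<in> H" "C (x\<^sub>1 * x\<^sub>2\<^sup>2) \<in> H" "C (x\<^sub>2 ^ 3 * x\<^sub>3) \<in> H"
      "C (x\<^sub>1 ^ 3 * x\<^sub>2\<^sup>2) \<in> H"
    and d: "D x\<^sub>1 \<in> H" "D (x\<^sub>2 * x\<^sub>3) \<in> H" "D (x\<^sub>1 ^ 3) \<in> H"
    and y: "T 1 \<in> H"
  shows "invariants \<subseteq> H"
proof -
  have add: "r + s \<in> H" and mult: "r * s \<in> H" if "r \<in> H" "s \<in> H" for r s
    using H that by (auto simp: subalgebra_def)
  have scalar: "ext_const (Poly_Mapping.single 0 c) \<in> H" for c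
    using H by (auto simp: subalgebra_def scalar_def)
  have minus: "- r \<in> H" if "r \<in> H" for r
    using mult[OF scalar[of "-1"] that] by (simp add: single_uminus ext_const_hom)
  define A where "A = {p. ext_const p \<in> H}"
  have A_add: "p + q \<in> A" and A_mult: "p * q \<in> A" if "p \<in> A" "q \<in> A" for p q
    using that add mult by (auto simp: A_def ext_const_hom)
  have A_minus: "- p \<in> A" if "p \<in> A" for p
    using that minus by (auto simp: A_def ext_const_hom)
  have A_const: "Poly_Mapping.single 0 c \<in> A" for c
    using scalar by (simp add: A_def)
  let ?e\<^sub>1 = "x\<^sub>1\<^sup>2 + x\<^sub>2\<^sup>2 + x\<^sub>3\<^sup>2" and ?e\<^sub>2 = "x\<^sub>1\<^sup>2 * x\<^sub>2\<^sup>2 + x\<^sub>2\<^sup>2 * x\<^sub>3\<^sup>2 + x\<^sub>3\<^sup>2 * x\<^sub>1\<^sup>2"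
  have rho_sym: "\<rho> ?e\<^sub>1 = ?e\<^sub>1" "\<rho> ?e\<^sub>2 = ?e\<^sub>2" "\<rho> (x\<^sub>1 * x\<^sub>2 * x\<^sub>3) = x\<^sub>1 * x\<^sub>2 * x\<^sub>3"
    by (simp_all add: ac_simps)
  have gens: "?e\<^sub>1 \<in> A" "x\<^sub>1 * x\<^sub>2 * x\<^sub>3 \<in> A" "x\<^sub>1 ^ 4 + x\<^sub>2 ^ 4 + x\<^sub>3 ^ 4 \<in> A"
      "x\<^sub>1 ^ 4 * x\<^sub>2\<^sup>2 + x\<^sub>1\<^sup>2 * x\<^sub>3 ^ 4 + x\<^sub>2 ^ 4 * x\<^sub>3\<^sup>2 \<in> A"
    using a by (simp_all add: A_def)
  \<comment> \<open>The square of \<open>?e\<^sub>1\<close> is the sum of the fourth powers plus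
    twice \<open>?e\<^sub>2\<close>, and \<open>- 2 = 1\<close>; the triple summand makes this an
    identity over any commutative ring and is removed by \<open>char_3\<close>.\<close>
  have e\<^sub>2_eq: "?e\<^sub>2 = (x\<^sub>1 ^ 4 + x\<^sub>2 ^ 4 + x\<^sub>3 ^ 4) + - (?e\<^sub>1 * ?e\<^sub>1) + (?e\<^sub>2 + ?e\<^sub>2 + ?e\<^sub>2)"
    by (simp add: power2_eq_square power4_eq_xxxx algebra_simps)
  have "x\<^sub>1 ^ 4 + x\<^sub>2 ^ 4 + x\<^sub>3 ^ 4 + - (?e\<^sub>1 * ?e\<^sub>1) \<in> A"
    by (intro A_add[OF gens(3)] A_minus A_mult gens)
  then have e\<^sub>2: "?e\<^sub>2 \<in> A"
    by (subst e\<^sub>2_eq[unfolded char_3 add_0_right])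
  have sym_inv: "p \<in> A" if "p \<in> sym_inv" for p
    by (rule sym_inv_generated[OF A_add A_mult A_const gens(1,2,3) e\<^sub>2 gens(4) that])
  have C: "C f \<in> H" if f: "f \<in> cov" for f
  proof -
    define K where "K = {f. C f \<in> H}"
    have K_mult: "p * f \<in> K" if "p \<in> A" "\<rho> p = p" "f \<in> K" for p f
      using that mult[of "ext_const p" "C f"] by (simp add: ext_const_mult_C A_def K_def)
    have K_add: "f + g \<in> K" if "f \<in> K" "g \<in> K" for f g using that add by (simp add: K_def C_add)
    have K_minus: "- f \<in> K" if "f \<in> K" for f using that minus by (simp add: K_def C_minus)
    have e\<^sub>1_K: "?e\<^sub>1 * f \<in> K" and e\<^sub>2_K: "?e\<^sub>2 * f \<in> K" and a\<^sub>2_K: "x\<^sub>1 * x\<^sub>2 * x\<^sub>3 * f \<in> K" if "f \<in> K" for f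
      by (rule K_mult; use that gens e\<^sub>2 rho_sym in simp)+
    have K: "x\<^sub>1 \<in> K" "x\<^sub>2 * x\<^sub>3 \<in> K" "x\<^sub>1 ^ 3 \<in> K" "x\<^sub>1 * x\<^sub>2\<^sup>2 \<in> K" "x\<^sub>2 ^ 3 * x\<^sub>3 \<in> K" "x\<^sub>1 ^ 3 * x\<^sub>2\<^sup>2 \<in> K"
      using c by (simp_all add: K_def)
    have "f \<in> K"
      by (rule cov_generated[OF K_add K_minus e\<^sub>1_K e\<^sub>2_K a\<^sub>2_K K f])
    then show ?thesis by (simp add: K_def)
  qed
  have D: "D f \<in> H" if f: "f \<in> cov" for f
  proof -
    define K where "K = {f. D f \<in> H}"
    have K_mult: "p * f \<in> K" if "p \<in> A" "\<rho> p = p" "f \<in> K" for p f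
      using that mult[of "ext_const p" "D f"] by (simp add: ext_const_mult_D A_def K_def)
    have K_add: "f + g \<in> K" if "f \<in> K" "g \<in> K" for f g using that add by (simp add: K_def D_add)
    have K_minus: "- f \<in> K" if "f \<in> K" for f using that minus by (simp add: K_def D_minus)
    have K_diff: "f - g \<in> K" if "f \<in> K" "g \<in> K" for f g
      using K_add[OF that(1) K_minus[OF that(2)]] by simp
    have K_CC: "\<rho> f * \<rho> (\<rho> g) - \<rho> (\<rho> f) * \<rho> g \<in> K" if "C f \<in> H" "C g \<in> H" for f g
      using mult[OF that] by (simp add: K_def C_mult_C)
    have K: "x\<^sub>1 \<in> K" "x\<^sub>2 * x\<^sub>3 \<in> K" "x\<^sub>1 ^ 3 \<in> K" using d by (simp_all add: K_def)
    have e\<^sub>1_K: "?e\<^sub>1 * f \<in> K" and e\<^sub>2_K: "?e\<^sub>2 * f \<in> K" and a\<^sub>2_K: "x\<^sub>1 * x\<^sub>2 * x\<^sub>3 * f \<in> K" if "f \<in> K" for f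
      by (rule K_mult; use that gens e\<^sub>2 rho_sym in simp)+
    \<comment> \<open>Three of the six module generators are not among the \<open>d\<^sub>i\<close>; they come from \<open>c\<^sub>1 c\<^sub>2\<close>, \<open>c\<^sub>1 c\<^sub>4\<close>, \<open>c\<^sub>2 c\<^sub>4\<close>.\<close>
    have 12: "x\<^sub>1 * x\<^sub>2\<^sup>2 - x\<^sub>1 * x\<^sub>3\<^sup>2 \<in> K"
      using K_CC[OF c(1,2)] by (simp add: power2_eq_square ac_simps)
    \<comment> \<open>The bracket equals twice \<open>x\<^sub>1 * x\<^sub>2\<^sup>2\<close>; again
      \<open>- 2 = 1\<close> in characteristic 3.\<close>
    have d\<^sub>4_eq: "x\<^sub>1 * x\<^sub>2\<^sup>2 = - (?e\<^sub>1 * x\<^sub>1 - x\<^sub>1 ^ 3 + (x\<^sub>1 * x\<^sub>2\<^sup>2 - x\<^sub>1 * x\<^sub>3\<^sup>2))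
        + (x\<^sub>1 * x\<^sub>2\<^sup>2 + x\<^sub>1 * x\<^sub>2\<^sup>2 + x\<^sub>1 * x\<^sub>2\<^sup>2)"
      by (simp add: power2_eq_square power3_eq_cube algebra_simps)
    have d\<^sub>4: "x\<^sub>1 * x\<^sub>2\<^sup>2 \<in> K"
      by (subst d\<^sub>4_eq[unfolded char_3 add_0_right]) (intro K_minus K_add K_diff e\<^sub>1_K K 12)
    have 14: "x\<^sub>2 * x\<^sub>3 * x\<^sub>1\<^sup>2 - x\<^sub>2 * x\<^sub>3 * x\<^sub>3\<^sup>2 \<in> K"
      using K_CC[OF c(1,4)] by (simp add: power2_eq_square ac_simps)
    have "x\<^sub>2 ^ 3 * x\<^sub>3 = ?e\<^sub>1 * (x\<^sub>2 * x\<^sub>3) + (x\<^sub>2 * x\<^sub>3 * x\<^sub>1\<^sup>2 - x\<^sub>2 * x\<^sub>3 * x\<^sub>3\<^sup>2)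
        - x\<^sub>1 * x\<^sub>2 * x\<^sub>3 * x\<^sub>1 - x\<^sub>1 * x\<^sub>2 * x\<^sub>3 * x\<^sub>1"
      by (simp add: power2_eq_square power3_eq_cube algebra_simps)
    then have d\<^sub>5: "x\<^sub>2 ^ 3 * x\<^sub>3 \<in> K"
      using K_diff[OF K_diff[OF K_add[OF e\<^sub>1_K[OF K(2)] 14] a\<^sub>2_K[OF K(1)]] a\<^sub>2_K[OF K(1)]] by (simp only:)
    have 24: "x\<^sub>1 ^ 3 * x\<^sub>3\<^sup>2 - x\<^sub>1 * x\<^sub>2 * x\<^sub>3 * (x\<^sub>2 * x\<^sub>3) \<in> K"
      using K_CC[OF c(2,4)] by (simp add: power2_eq_square power3_eq_cube ac_simps)
    have "x\<^sub>1 ^ 3 * x\<^sub>2\<^sup>2 = ?e\<^sub>2 * x\<^sub>1 - (x\<^sub>1 ^ 3 * x\<^sub>3\<^sup>2 - x\<^sub>1 * x\<^sub>2 * x\<^sub>3 * (x\<^sub>2 * x\<^sub>3))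
        - x\<^sub>1 * x\<^sub>2 * x\<^sub>3 * (x\<^sub>2 * x\<^sub>3) - x\<^sub>1 * x\<^sub>2 * x\<^sub>3 * (x\<^sub>2 * x\<^sub>3)"
      by (simp add: power2_eq_square power3_eq_cube algebra_simps)
    then have d\<^sub>6: "x\<^sub>1 ^ 3 * x\<^sub>2\<^sup>2 \<in> K"
      using K_diff[OF K_diff[OF K_diff[OF e\<^sub>2_K[OF K(1)] 24] a\<^sub>2_K[OF K(2)]] a\<^sub>2_K[OF K(2)]] by (simp only:)
    have "f \<in> K"
      by (rule cov_generated[OF K_add K_minus e\<^sub>1_K e\<^sub>2_K a\<^sub>2_K K(1,2,3) d\<^sub>4 d\<^sub>5 d\<^sub>6 f])
    then show ?thesis by (simp add: K_def)
  qed
  show ?thesis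
  proof
    fix r assume "r \<in> invariants"
    note r = invariants_cases[OF this]
    have "T (co123 r) \<in> H"
      using mult[OF _ y, of "ext_const (co123 r)"] sym_inv[OF r(5)] by (simp add: ext_const_mult_T A_def)
    then show "r \<in> H"
      using add C[OF r(3)] D[OF r(4)] sym_inv[OF r(2)] by (subst r(1)) (simp add: A_def)
  qed
qed

section \<open>Derivations along the augmentation\<close>

lemma subalgebra_invariants: "subalgebra invariants"
  using alg_hom_act[OF gU_gS_SL2(1)] alg_hom_act[OF gU_gS_SL2(2)]
  by (simp add: subalgebra_def invariants_iff alg_hom_def)

text \<open>The augmentation is the constant coefficient of \<open>co0\<close>. The product rule is
  stated on invariants because the functionals used later satisfy it through the symmetry and parity
  of invariant coefficients.\<close>

definition derivation :: "(sym_ext_alg \<Rightarrow> F3) \<Rightarrow> bool" where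
  "derivation L \<longleftrightarrow> (\<forall>c. L (scalar c) = 0) \<and> (\<forall>r s. L (r + s) = L r + L s) \<and>
    (\<forall>r\<in>invariants. \<forall>s\<in>invariants. L (r * s) = cf (co0 r) 0 0 0 * L s + cf (co0 s) 0 0 0 * L r)"

text \<open>The kernel of \<open>L\<close> in the invariants is a subalgebra. It contains every
  element of \<open>B\<close> except \<open>g\<close>, so no subset of \<open>B\<close> omitting
  \<open>g\<close> generates.\<close>

lemma minimally_generated_invariantsI:
  assumes gen: "subalgebra hull B = invariants"
    and L: "\<And>g. g \<in> B \<Longrightarrow> \<exists>L. derivation L \<and> L g \<noteq> 0 \<and> (\<forall>h\<in>B. h = g \<or> L h = 0)"
  shows "minimally_generated invariants B"
  unfolding minimally_generated_def
proof (intro conjI allI impI gen)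
  fix C assume C: "C \<subset> B"
  then obtain g where g: "g \<in> B" "g \<notin> C" by blast
  obtain L where L: "derivation L" "L g \<noteq> 0" "\<forall>h\<in>B. h = g \<or> L h = 0" using L[OF g(1)] by blast
  have B: "B \<subseteq> invariants" using hull_subset[of B subalgebra] gen by simp
  have "subalgebra {r \<in> invariants. L r = 0}"
    using subalgebra_invariants L(1) by (simp add: subalgebra_def derivation_def)
  moreover have "C \<subseteq> {r \<in> invariants. L r = 0}" using B C g L(3) by (auto 0 3)
  ultimately have "subalgebra hull C \<subseteq> {r \<in> invariants. L r = 0}" by (rule hull_minimal[rotated])
  then show "subalgebra hull C \<noteq> invariants" using L(2) g B by blast
qed

section \<open>Minimality\<close>

lemma sym_inv_cyclic:
  assumes "p \<in> sym_inv"
  shows "cf p 0 2 0 = cf p 2 0 0" "cf p 0 0 2 = cf p 2 0 0"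
    "cf p 0 4 0 = cf p 4 0 0" "cf p 0 0 4 = cf p 4 0 0"
    "cf p 0 2 2 = cf p 2 2 0" "cf p 2 0 2 = cf p 2 2 0"
proof -
  have "cf p i j k = cf p j k i" for i j k using assms sym_inv_iff by blast
  then show "cf p 0 2 0 = cf p 2 0 0" "cf p 0 0 2 = cf p 2 0 0"
    "cf p 0 4 0 = cf p 4 0 0" "cf p 0 0 4 = cf p 4 0 0"
    "cf p 0 2 2 = cf p 2 2 0" "cf p 2 0 2 = cf p 2 2 0" by metis+
qed

text \<open>In successor form the finite sums of \<open>cf_mult\<close> unfold term by term.\<close>

lemma nat_1_to_4: "(2::nat) = Suc (Suc 0)" "(3::nat) = Suc (Suc (Suc 0))" "(4::nat) = Suc (Suc (Suc (Suc 0)))" "(1::nat) = Suc 0"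
  by simp_all

lemma F3_triple: "3 * c = (0 :: F3)"
  using exhaust_3[of c] by auto

text \<open>
  Each generator has a combination of coefficients in its own bidegree that vanishes on all products of
  invariants of positive degree and on the remaining generators of that bidegree. The weights come from
  solving this linear system over \<open>\<bbbF>\<^sub>3\<close>.
\<close>

lemma sym_inv_functionals:
  fixes p q :: sym_alg
  assumes p: "p \<in> sym_inv" and q: "q \<in> sym_inv"
  defines "L \<equiv> \<lambda>l. l (p * q) = cf p 0 0 0 * l q + cf q 0 0 0 * (l p :: F3)"
  shows "L (\<lambda>p. cf p 2 0 0)" "L (\<lambda>p. cf p 1 1 1)"
    "L (\<lambda>p. cf p 4 0 0 + cf p 2 2 0)" "L (\<lambda>p. cf p 4 2 0 - cf p 2 4 0)"
  using sym_inv_cyclic[OF p] sym_inv_cyclic[OF q]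
  unfolding L_def cf_simps cf_mult nat_1_to_4
  by (simp_all add: F3_triple sym_inv_parity[OF p] sym_inv_parity[OF q] algebra_simps)

text \<open>The first six serve exterior degree 1; the first two and the last serve degree 2. There
  \<open>x\<^sub>1 * x\<^sub>2\<^sup>2 - x\<^sub>1 * x\<^sub>3\<^sup>2\<close>, from the product of
  \<open>c\<^sub>1\<close> and \<open>c\<^sub>2\<close>, must be killed as well, which the third and
  fourth fail to do.\<close>

lemma sym_inv_cov_functionals:
  fixes p f :: sym_alg
  assumes p: "p \<in> sym_inv" and f: "f \<in> cov"
  defines "L \<equiv> \<lambda>l. l (p * f) = cf p 0 0 0 * (l f :: F3)"
  shows "L (\<lambda>f. cf f 1 0 0)" "L (\<lambda>f. cf f 0 1 1)"
    "L (\<lambda>f. cf f 3 0 0 - cf f 1 0 2)" "L (\<lambda>f. cf f 1 2 0 - cf f 1 0 2)"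
    "L (\<lambda>f. cf f 0 3 1 - cf f 0 1 3)"
    "L (\<lambda>f. cf f 3 2 0 - cf f 3 0 2 - cf f 1 4 0 + cf f 1 0 4)"
    "L (\<lambda>f. cf f 3 0 0 + cf f 1 2 0 + cf f 1 0 2)"
  using sym_inv_cyclic[OF p]
  unfolding L_def cf_simps cf_mult nat_1_to_4
  by (simp_all add: F3_triple sym_inv_parity[OF p] cov_parity[OF f] algebra_simps)

text \<open>In these low degrees only the multiples of \<open>x\<^sub>1\<close> and
  \<open>x\<^sub>2 * x\<^sub>3\<close> in \<open>f\<close> and \<open>g\<close> matter. Two
  multiples of \<open>x\<^sub>1\<close> cancel by antisymmetry; a mixed pair gives a multiple of
  \<open>x\<^sub>1 * x\<^sub>2\<^sup>2 - x\<^sub>1 * x\<^sub>3\<^sup>2\<close>, where the last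
  functional vanishes.\<close>

lemma cov_cov_functionals:
  fixes f g :: sym_alg
  assumes f: "f \<in> cov" and g: "g \<in> cov"
  defines "L \<equiv> \<lambda>l. l (\<rho> f * \<rho> (\<rho> g) - \<rho> (\<rho> f) * \<rho> g) = (0 :: F3)"
  shows "L (\<lambda>f. cf f 1 0 0)" "L (\<lambda>f. cf f 0 1 1)"
    "L (\<lambda>f. cf f 3 0 0 + cf f 1 2 0 + cf f 1 0 2)"
  unfolding L_def cf_simps cf_mult nat_1_to_4
  by (simp_all add: cov_parity[OF f] cov_parity[OF g] algebra_simps)

section \<open>From linear forms on polynomials to derivations\<close>

definition "linear_form l \<longleftrightarrow> (\<forall>p q :: sym_alg. l (p + q) = (l p + l q :: F3))"

lemma linear_form_zero: "linear_form l \<Longrightarrow> l 0 = 0"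
  unfolding linear_form_def by (metis add_cancel_right_right add_0_right)

lemma derivation_co0:
  assumes l: "linear_form l" and const: "\<And>c. l (Poly_Mapping.single 0 c) = 0"
    and "\<And>p q. p \<in> sym_inv \<Longrightarrow> q \<in> sym_inv \<Longrightarrow> l (p * q) = cf p 0 0 0 * l q + cf q 0 0 0 * l p"
  shows "derivation (\<lambda>r. l (co0 r))"
  using assms invariants_cases(2)
  by (simp add: derivation_def linear_form_def scalar_def)

lemma derivation_co1:
  assumes l: "linear_form l"
    and sym_inv_cov: "\<And>p f. p \<in> sym_inv \<Longrightarrow> f \<in> cov \<Longrightarrow> l (p * f) = cf p 0 0 0 * l f"
  shows "derivation (\<lambda>r. l (co1 r))"
  using assms linear_form_zero[OF l] invariants_cases(2,3)
  by (simp add: derivation_def linear_form_def scalar_def mult.commute[of "co1 _"])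

text \<open>Besides the products with \<open>co0\<close>, this component receives the cross product
  of two parts of exterior degree 1, which \<open>cov_cov\<close> removes.\<close>

lemma derivation_co23:
  assumes l: "linear_form l"
    and sym_inv_cov: "\<And>p f. p \<in> sym_inv \<Longrightarrow> f \<in> cov \<Longrightarrow> l (p * f) = cf p 0 0 0 * l f"
    and cov_cov: "\<And>f g. f \<in> cov \<Longrightarrow> g \<in> cov \<Longrightarrow> l (\<rho> f * \<rho> (\<rho> g) - \<rho> (\<rho> f) * \<rho> g) = 0"
  shows "derivation (\<lambda>r. l (co23 r))"
  unfolding derivation_def
proof (intro conjI allI ballI)
  fix r s assume r: "r \<in> invariants" and s: "s \<in> invariants"
  have "co23 (r * s) = co0 r * co23 s + co0 s * co23 r
      + (\<rho> (co1 r) * \<rho> (\<rho> (co1 s)) - \<rho> (\<rho> (co1 r)) * \<rho> (co1 s))"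
    using invariants_cases(6,7)[OF r] invariants_cases(6,7)[OF s] by (simp add: algebra_simps)
  then show "l (co23 (r * s)) = cf (co0 r) 0 0 0 * l (co23 s) + cf (co0 s) 0 0 0 * l (co23 r)"
    using l sym_inv_cov[OF invariants_cases(2)[OF r] invariants_cases(4)[OF s]]
      sym_inv_cov[OF invariants_cases(2)[OF s] invariants_cases(4)[OF r]]
      cov_cov[OF invariants_cases(3)[OF r] invariants_cases(3)[OF s]]
    by (simp only: linear_form_def add_0_right)
qed (use l linear_form_zero[OF l] in \<open>auto simp: linear_form_def scalar_def\<close>)

text \<open>Elements of \<open>cov\<close> have no constant term, so products of parts of exterior
  degrees 1 and 2 do not reach the constant coefficient.\<close>

lemma derivation_co123: "derivation (\<lambda>r. cf (co123 r) 0 0 0)"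
  unfolding derivation_def
proof (intro conjI allI ballI)
  fix r s assume r: "r \<in> invariants" and s: "s \<in> invariants"
  have "cf (co1 r) 0 0 0 = 0" "cf (co2 r) 0 0 0 = 0" "cf (co3 r) 0 0 0 = 0"
      "cf (co1 s) 0 0 0 = 0" "cf (co2 s) 0 0 0 = 0" "cf (co3 s) 0 0 0 = 0"
    using invariants_cases[OF r] invariants_cases[OF s] by (simp_all add: cov_parity)
  then show "cf (co123 (r * s)) 0 0 0 = cf (co0 r) 0 0 0 * cf (co123 s) 0 0 0 + cf (co0 s) 0 0 0 * cf (co123 r) 0 0 0"
    by (simp add: cf_mult mult.commute)
qed (simp_all add: scalar_def)

lemma linear_form_cf: "linear_form (\<lambda>p. cf p i j k)"
  and linear_form_add: "linear_form l \<Longrightarrow> linear_form l' \<Longrightarrow> linear_form (\<lambda>p. l p + l' p)"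
  and linear_form_diff: "linear_form l \<Longrightarrow> linear_form l' \<Longrightarrow> linear_form (\<lambda>p. l p - l' p)"
  by (simp_all add: linear_form_def)

lemmas linear_form_intros = linear_form_cf linear_form_add linear_form_diff

lemma cf_const: "cf (Poly_Mapping.single 0 c) i j k = (if i = 0 \<and> j = 0 \<and> k = 0 then c else 0)"
  unfolding expo_zero[symmetric] by (auto simp: cf_single)

lemma derivations_co0:
  "derivation (\<lambda>r. cf (co0 r) 2 0 0)" "derivation (\<lambda>r. cf (co0 r) 1 1 1)"
  "derivation (\<lambda>r. cf (co0 r) 4 0 0 + cf (co0 r) 2 2 0)"
  "derivation (\<lambda>r. cf (co0 r) 4 2 0 - cf (co0 r) 2 4 0)"
  by (rule derivation_co0, intro linear_form_intros, simp add: cf_const, rule sym_inv_functionals, assumption+)+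

lemma derivations_co1:
  "derivation (\<lambda>r. cf (co1 r) 1 0 0)" "derivation (\<lambda>r. cf (co1 r) 0 1 1)"
  "derivation (\<lambda>r. cf (co1 r) 3 0 0 - cf (co1 r) 1 0 2)"
  "derivation (\<lambda>r. cf (co1 r) 1 2 0 - cf (co1 r) 1 0 2)"
  "derivation (\<lambda>r. cf (co1 r) 0 3 1 - cf (co1 r) 0 1 3)"
  "derivation (\<lambda>r. cf (co1 r) 3 2 0 - cf (co1 r) 3 0 2 - cf (co1 r) 1 4 0 + cf (co1 r) 1 0 4)"
  by (rule derivation_co1, intro linear_form_intros, rule sym_inv_cov_functionals, assumption+)+

lemma derivations_co23:
  "derivation (\<lambda>r. cf (co23 r) 1 0 0)" "derivation (\<lambda>r. cf (co23 r) 0 1 1)"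
  "derivation (\<lambda>r. cf (co23 r) 3 0 0 + cf (co23 r) 1 2 0 + cf (co23 r) 1 0 2)"
  by (rule derivation_co23, intro linear_form_intros, rule sym_inv_cov_functionals, assumption+,
      rule cov_cov_functionals, assumption+)+

section \<open>The fourteen generators and the conclusion\<close>

lemma ext_const_power:
  "ext_const p ^ n = (ext_const (p ^ n) :: ('i::{finite,linorder}, 'a::comm_ring_1) ext_alg)"
  by (induction n) (simp_all add: ext_const_hom)

text \<open>The generators of exterior degree 1 and 2 are cyclic sums, so the coefficient in the
  first summand determines each of them.\<close>

lemma generators_eq:
  "X 1 ^ 2 + X 2 ^ 2 + X 3 ^ 2 = ext_const (x\<^sub>1\<^sup>2 + x\<^sub>2\<^sup>2 + x\<^sub>3\<^sup>2)"
  "X 1 * X 2 * X 3 = ext_const (x\<^sub>1 * x\<^sub>2 * x\<^sub>3)"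
  "X 1 ^ 4 + X 2 ^ 4 + X 3 ^ 4 = ext_const (x\<^sub>1 ^ 4 + x\<^sub>2 ^ 4 + x\<^sub>3 ^ 4)"
  "X 1 ^ 4 * X 2 ^ 2 + X 1 ^ 2 * X 3 ^ 4 + X 2 ^ 4 * X 3 ^ 2
    = ext_const (x\<^sub>1 ^ 4 * x\<^sub>2\<^sup>2 + x\<^sub>1\<^sup>2 * x\<^sub>3 ^ 4 + x\<^sub>2 ^ 4 * x\<^sub>3\<^sup>2)"
  "X 1 * Y 1 + X 2 * Y 2 + X 3 * Y 3 = C x\<^sub>1"
  "X 2 * X 3 * Y 1 + X 3 * X 1 * Y 2 + X 1 * X 2 * Y 3 = C (x\<^sub>2 * x\<^sub>3)"
  "X 1 ^ 3 * Y 1 + X 2 ^ 3 * Y 2 + X 3 ^ 3 * Y 3 = C (x\<^sub>1 ^ 3)"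
  "X 1 * X 2 ^ 2 * Y 1 + X 2 * X 3 ^ 2 * Y 2 + X 3 * X 1 ^ 2 * Y 3 = C (x\<^sub>1 * x\<^sub>2\<^sup>2)"
  "X 2 ^ 3 * X 3 * Y 1 + X 3 ^ 3 * X 1 * Y 2 + X 1 ^ 3 * X 2 * Y 3 = C (x\<^sub>2 ^ 3 * x\<^sub>3)"
  "X 1 ^ 3 * X 2 ^ 2 * Y 1 + X 2 ^ 3 * X 3 ^ 2 * Y 2 + X 3 ^ 3 * X 1 ^ 2 * Y 3 = C (x\<^sub>1 ^ 3 * x\<^sub>2\<^sup>2)"
  "X 1 * Y 2 * Y 3 + X 2 * Y 3 * Y 1 + X 3 * Y 1 * Y 2 = D x\<^sub>1"
  "X 2 * X 3 * Y 2 * Y 3 + X 3 * X 1 * Y 3 * Y 1 + X 1 * X 2 * Y 1 * Y 2 = D (x\<^sub>2 * x\<^sub>3)"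
  "X 1 ^ 3 * Y 2 * Y 3 + X 2 ^ 3 * Y 3 * Y 1 + X 3 ^ 3 * Y 1 * Y 2 = D (x\<^sub>1 ^ 3)"
  "Y 1 * Y 2 * Y 3 = T 1"
  unfolding X_eq ext_const_power C_def D_def T_def rho_hom rho_power mult.assoc
  unfolding ext_const_hom mult.assoc by simp_all

lemma generators_invariant:
  "x\<^sub>1\<^sup>2 + x\<^sub>2\<^sup>2 + x\<^sub>3\<^sup>2 \<in> sym_inv" "x\<^sub>1 * x\<^sub>2 * x\<^sub>3 \<in> sym_inv" "x\<^sub>1 ^ 4 + x\<^sub>2 ^ 4 + x\<^sub>3 ^ 4 \<in> sym_inv"
  "x\<^sub>1 ^ 4 * x\<^sub>2\<^sup>2 + x\<^sub>1\<^sup>2 * x\<^sub>3 ^ 4 + x\<^sub>2 ^ 4 * x\<^sub>3\<^sup>2 \<in> sym_inv" "1 \<in> sym_inv"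
  "x\<^sub>1 \<in> cov" "x\<^sub>2 * x\<^sub>3 \<in> cov" "x\<^sub>1 ^ 3 \<in> cov" "x\<^sub>1 * x\<^sub>2\<^sup>2 \<in> cov" "x\<^sub>2 ^ 3 * x\<^sub>3 \<in> cov" "x\<^sub>1 ^ 3 * x\<^sub>2\<^sup>2 \<in> cov"
  by (simp_all add: sym_inv_def cov_def ac_simps)

lemma cf_x_powers:
  "cf (x\<^sub>1 ^ a * x\<^sub>2 ^ b * x\<^sub>3 ^ c) i j k = (if i = a \<and> j = b \<and> k = c then 1 else 0)"
  by (auto simp: x_powers cf_single)

lemma cf_x:
  "cf x\<^sub>1 i j k = (if i = 1 \<and> j = 0 \<and> k = 0 then 1 else 0)"
  "cf (x\<^sub>1 ^ n) i j k = (if i = n \<and> j = 0 \<and> k = 0 then 1 else 0)"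
  "cf (x\<^sub>2 ^ n) i j k = (if i = 0 \<and> j = n \<and> k = 0 then 1 else 0)"
  "cf (x\<^sub>3 ^ n) i j k = (if i = 0 \<and> j = 0 \<and> k = n then 1 else 0)"
  "cf (x\<^sub>2 * x\<^sub>3) i j k = (if i = 0 \<and> j = 1 \<and> k = 1 then 1 else 0)"
  "cf (x\<^sub>1 * x\<^sub>2 * x\<^sub>3) i j k = (if i = 1 \<and> j = 1 \<and> k = 1 then 1 else 0)"
  "cf (x\<^sub>1 * x\<^sub>2 ^ m) i j k = (if i = 1 \<and> j = m \<and> k = 0 then 1 else 0)"
  "cf (x\<^sub>1 ^ n * x\<^sub>2 ^ m) i j k = (if i = n \<and> j = m \<and> k = 0 then 1 else 0)"
  "cf (x\<^sub>1 ^ n * x\<^sub>3 ^ m) i j k = (if i = n \<and> j = 0 \<and> k = m then 1 else 0)"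
  "cf (x\<^sub>2 ^ n * x\<^sub>3 ^ m) i j k = (if i = 0 \<and> j = n \<and> k = m then 1 else 0)"
  "cf (x\<^sub>2 ^ n * x\<^sub>3) i j k = (if i = 0 \<and> j = n \<and> k = 1 then 1 else 0)"
  "cf 1 i j k = (if i = 0 \<and> j = 0 \<and> k = 0 then 1 else 0)"
  using cf_x_powers[of 1 0 0] cf_x_powers[of n 0 0] cf_x_powers[of 0 n 0] cf_x_powers[of 0 0 n]
    cf_x_powers[of 0 1 1] cf_x_powers[of 1 1 1] cf_x_powers[of 1 m 0] cf_x_powers[of n m 0]
    cf_x_powers[of n 0 m] cf_x_powers[of 0 n m] cf_x_powers[of 0 n 1] cf_x_powers[of 0 0 0]
  by simp_all

theorem theorem9:
  defines "a\<^sub>1 \<equiv> X 1 ^ 2 + X 2 ^ 2 + X 3 ^ 2"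
    and "a\<^sub>2 \<equiv> X 1 * X 2 * X 3"
    and "a\<^sub>3 \<equiv> X 1 ^ 4 + X 2 ^ 4 + X 3 ^ 4"
    and "b \<equiv> X 1 ^ 4 * X 2 ^ 2 + X 1 ^ 2 * X 3 ^ 4 + X 2 ^ 4 * X 3 ^ 2"
    and "c\<^sub>1 \<equiv> X 1 * Y 1 + X 2 * Y 2 + X 3 * Y 3"
    and "c\<^sub>2 \<equiv> X 2 * X 3 * Y 1 + X 3 * X 1 * Y 2 + X 1 * X 2 * Y 3"
    and "c\<^sub>3 \<equiv> X 1 ^ 3 * Y 1 + X 2 ^ 3 * Y 2 + X 3 ^ 3 * Y 3"
    and "c\<^sub>4 \<equiv> X 1 * X 2 ^ 2 * Y 1 + X 2 * X 3 ^ 2 * Y 2 + X 3 * X 1 ^ 2 * Y 3"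
    and "c\<^sub>5 \<equiv> X 2 ^ 3 * X 3 * Y 1 + X 3 ^ 3 * X 1 * Y 2 + X 1 ^ 3 * X 2 * Y 3"
    and "c\<^sub>6 \<equiv> X 1 ^ 3 * X 2 ^ 2 * Y 1 + X 2 ^ 3 * X 3 ^ 2 * Y 2 + X 3 ^ 3 * X 1 ^ 2 * Y 3"
    and "d\<^sub>1 \<equiv> X 1 * Y 2 * Y 3 + X 2 * Y 3 * Y 1 + X 3 * Y 1 * Y 2"
    and "d\<^sub>2 \<equiv> X 2 * X 3 * Y 2 * Y 3 + X 3 * X 1 * Y 3 * Y 1 + X 1 * X 2 * Y 1 * Y 2"
    and "d\<^sub>3 \<equiv> X 1 ^ 3 * Y 2 * Y 3 + X 2 ^ 3 * Y 3 * Y 1 + X 3 ^ 3 * Y 1 * Y 2"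
  shows "minimally_generated invariants
    {a\<^sub>1, a\<^sub>2, a\<^sub>3, b, c\<^sub>1, c\<^sub>2, c\<^sub>3, c\<^sub>4, c\<^sub>5, c\<^sub>6, d\<^sub>1, d\<^sub>2, d\<^sub>3, Y 1 * Y 2 * Y 3}"
    (is "minimally_generated invariants ?B")
proof (rule minimally_generated_invariantsI)
  note defs = a\<^sub>1_def a\<^sub>2_def a\<^sub>3_def b_def c\<^sub>1_def c\<^sub>2_def c\<^sub>3_def c\<^sub>4_def c\<^sub>5_def c\<^sub>6_def
    d\<^sub>1_def d\<^sub>2_def d\<^sub>3_def generators_eq
  show "subalgebra hull ?B = invariants"
  proof
    have "?B \<subseteq> invariants"
      unfolding defs using generators_invariant by (simp add: invariants_intros)
    then show "subalgebra hull ?B \<subseteq> invariants"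
      using subalgebra_invariants by (rule hull_minimal)
    show "invariants \<subseteq> subalgebra hull ?B"
      unfolding defs by (rule invariants_generated; (rule subalgebra_hull | rule hull_inc, simp))
  qed
  fix g assume "g \<in> ?B"
  then consider "g = a\<^sub>1" | "g = a\<^sub>2" | "g = a\<^sub>3" | "g = b" | "g = c\<^sub>1" | "g = c\<^sub>2" | "g = c\<^sub>3" | "g = c\<^sub>4"
    | "g = c\<^sub>5" | "g = c\<^sub>6" | "g = d\<^sub>1" | "g = d\<^sub>2" | "g = d\<^sub>3" | "g = T 1"
    unfolding generators_eq by blast
  \<comment> \<open>Each case takes the functional for the component and polynomial degree of its
    generator; its values on all generators are read off from their monomials.\<close>
  then show "\<exists>L. derivation L \<and> L g \<noteq> 0 \<and> (\<forall>h\<in>?B. h = g \<or> L h = 0)"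
  proof cases
    case 1
    show ?thesis unfolding 1 defs by (rule exI, rule conjI, rule derivations_co0(1)) (simp add: cf_x)
  next
    case 2
    show ?thesis unfolding 2 defs by (rule exI, rule conjI, rule derivations_co0(2)) (simp add: cf_x)
  next
    case 3
    show ?thesis unfolding 3 defs by (rule exI, rule conjI, rule derivations_co0(3)) (simp add: cf_x)
  next
    case 4
    show ?thesis unfolding 4 defs by (rule exI, rule conjI, rule derivations_co0(4)) (simp add: cf_x)
  next
    case 5
    show ?thesis unfolding 5 defs by (rule exI, rule conjI, rule derivations_co1(1)) (simp add: cf_x)
  next
    case 6
    show ?thesis unfolding 6 defs by (rule exI, rule conjI, rule derivations_co1(2)) (simp add: cf_x)
  next
    case 7
    show ?thesis unfolding 7 defs by (rule exI, rule conjI, rule derivations_co1(3)) (simp add: cf_x)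
  next
    case 8
    show ?thesis unfolding 8 defs by (rule exI, rule conjI, rule derivations_co1(4)) (simp add: cf_x)
  next
    case 9
    show ?thesis unfolding 9 defs by (rule exI, rule conjI, rule derivations_co1(5)) (simp add: cf_x)
  next
    case 10
    show ?thesis unfolding 10 defs by (rule exI, rule conjI, rule derivations_co1(6)) (simp add: cf_x)
  next
    case 11
    show ?thesis unfolding 11 defs by (rule exI, rule conjI, rule derivations_co23(1)) (simp add: cf_x)
  next
    case 12
    show ?thesis unfolding 12 defs by (rule exI, rule conjI, rule derivations_co23(2)) (simp add: cf_x)
  next
    case 13
    show ?thesis unfolding 13 defs by (rule exI, rule conjI, rule derivations_co23(3)) (simp add: cf_x)
  next
    case 14
    show ?thesis unfolding 14 defs by (rule exI, rule conjI, rule derivation_co123) (simp add: cf_x)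
  qed
qed

end
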